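(* Let $X$ be a real random variable with $\mathbb{E}[e^X]=1$, cumulative distribution function $F$, $\bar F=1-F$, and (whenever it exists) density $f$. Let $c(k)=\int_k^\infty (e^x-e^k)\,dF(x)$ and let $V(k)$ be the Black–Scholes implied volatility at log-strike $k$, i.e. the unique $V(k)$ with $c_{BS}(k,V(k))=c(k)$. Let $\alpha>0$ and assume $$\text{(IR)}\qquad \exists\,\epsilon>0:\ \mathbb{E}[e^{(1+\epsilon)X}]<\infty .$$ Consider the conditions (i) $-\log f(k)\in R_\alpha$; (ii) $-\log \bar F(k)\in R_\alpha$; (iii) $-\log c(k)\in R_\alpha$; (iv) $V(k)^2/k\sim \psi\left[-\log c(k)/k\right]$ as $k\to\infty$. Then (i) $\Rightarrow$ (ii) $\Rightarrow$ (iii) $\Rightarrow$ (iv). Moreover: if (ii) holds, then $-\log c(k)\sim -k-\log\bar F(k)$ and $V(k)^2/k\sim \psi\left[-1-\log \bar F(k)/k\right]$; if (i) holds, then $-\log f(k)\sim -\log \bar F(k)$ and $V(k)^2/k\sim \psi\left[-1-\log f(k)/k\right]$. Finally, if (i) holds and $-\log f(k)/k\to\infty$, or (ii) holds and $-\log\bar F(k)/k\to\infty$, or (iii) holds and $-\log c(k)/k\to\infty$ as $k\to\infty$, then $V(k)^2$ is sublinear, namely, respectively, $$\frac{V(k)^2}{k}\sim \frac{1}{-2\log f(k)/k},\qquad \frac{V(k)^2}{k}\sim \frac{1}{-2\log \bar F(k)/k},\qquad \frac{V(k)^2}{k}\sim \frac{1}{-2\log c(k)/k}.$$ All asymptotics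 are as $k\to+\infty$.
   Context: $X$ models risk-neutral log-returns (so $\mathbb{E}[e^X]=1$). The normalized Black–Scholes call price with log-strike $k$ and total volatility $\sigma>0$ is $c_{BS}(k,\sigma)=\Phi(d_1)-e^k\Phi(d_2)$ with $d_{1,2}=-k/\sigma\pm\sigma/2$, $\Phi$ the standard normal distribution function. The function $\psi:[0,\infty]\to[0,2]$ is $\psi[x]=2-4\left(\sqrt{x^2+x}-x\right)$. A measurable function $g$, positive for large $x$, is in $R_\alpha$ (regularly varying at $+\infty$ with index $\alpha$) if $\lim_{x\to\infty} g(\lambda x)/g(x)=\lambda^\alpha$ for every $\lambda>0$. $g\sim h$ means $g(k)/h(k)\to1$ as $k\to\infty$. *)

theory Defs
  imports "HOL-Probability.Probability" "HOL-Library.Landau_Symbols"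
begin

definition Phi :: "real \<Rightarrow> real" where
  "Phi x = (LINT t:{..x}|lborel. std_normal_density t)"

text \<open>Normalized Black--Scholes call price, log-strike k, total volatility s.\<close>
definition cBS :: "real \<Rightarrow> real \<Rightarrow> real" where
  "cBS k s = Phi (- k / s + s / 2) - exp k * Phi (- k / s - s / 2)"

text \<open>M is the law of X (a probability measure on the Borel sets of the reals).\<close>
definition Fbar :: "real measure \<Rightarrow> real \<Rightarrow> real" where
  "Fbar M k = measure M {k<..}"

definition callp :: "real measure \<Rightarrow> real \<Rightarrow> real" where
  "callp M k = (LINT x:{k<..}|M. exp x - exp k)"

definition impvol :: "real measure \<Rightarrow> real \<Rightarrow> real" where
  "impvol M k = (THE s. s > 0 \<and> cBS k s = callp M k)"

definition psi :: "real \<Rightarrow> real" where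
  "psi x = 2 - 4 * (sqrt (x\<^sup>2 + x) - x)"

definition regvar :: "real \<Rightarrow> (real \<Rightarrow> real) \<Rightarrow> bool" where
  "regvar a g \<longleftrightarrow> g \<in> borel_measurable borel \<and> (\<forall>\<^sub>F x in at_top. g x > 0) \<and>
     (\<forall>l>0. ((\<lambda>x. g (l * x) / g x) \<longlongrightarrow> l powr a) at_top)"

definition is_density :: "real measure \<Rightarrow> (real \<Rightarrow> real) \<Rightarrow> bool" where
  "is_density M f \<longleftrightarrow> f \<in> borel_measurable borel \<and> (\<forall>x. 0 \<le> f x) \<and>
     M = density lborel (\<lambda>x. ennreal (f x))"

end

theory Submission
  imports Defs "HOL-Real_Asymp.Real_Asymp"
begin

text \<open>
  Write \<open>D = k / V - V / 2\<close> for minus \<open>d\<^sub>1\<close> at the implied volatility \<open>V\<close>. As long as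
  \<open>V\<^sup>2 \<le> 2 k\<close> one has exactly \<open>V\<^sup>2 / k = psi (D\<^sup>2 / (2 k))\<close>, so the implied volatility is governed by
  comparing \<open>D\<^sup>2 / 2\<close> with \<open>L = - ln c\<close>. Chernoff's bound gives \<open>D\<^sup>2 / 2 \<le> L\<close>; integrating the vega
  over \<open>[(1 - n) V, V]\<close> gives the converse up to a factor close to 1. These suffice because
  \<open>psi x = 2 / (sqrt x + sqrt (x + 1))\<^sup>2\<close> changes by at most the same factor as its argument.

  The transfer between density, tail and call price rests on Potter's bounds for regularly varying
  functions. The exponential moment forces \<open>G = - ln Fbar \<ge> (1 + e / 2) k\<close>; hence the index
  is at least 1 and \<open>G - k\<close> stays comparable to \<open>G\<close>, so relative errors in \<open>G\<close> are relative errors in \<open>G - k\<close>.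
\<close>

section \<open>Regular variation\<close>

text \<open>The obstacle is uniformity. A density need not be monotone, so pointwise limits of
  ratios say nothing about its values on a whole interval; measurability alone has to upgrade them
  to uniform limits. The tail is monotone, and there finitely many ratio limits on a geometric grid
  suffice, with the exponential moment covering everything beyond the grid.

  The critical index is 1. There \<open>k\<close> and \<open>G\<close> may have the same order and
  \<open>k / G k\<close> need not converge, so the argument of \<open>psi\<close> may stay bounded
  and oscillate. Continuity of \<open>psi\<close> at a limit point is therefore no help, and all
  errors are kept multiplicative and measured against \<open>G k - k\<close>.

  Only logarithms of prices matter. That is why Chernoff's bound without a Mills-type prefactor is
  sharp enough, and why the prefactor proportional to \<open>V\<close> in the vega estimate is
  harmless: \<open>V\<close> is bounded below by a power of \<open>L\<close>, which
  \<open>exp (- (n * L))\<close> beats.\<close>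

text \<open>Dominated convergence makes the bad shifts in a bounded interval small in measure.
  Translation preserves measure, so for every \<open>t\<close> at once the values \<open>h u\<close>
  and \<open>h (u + t)\<close> can be compared through a common third value
  \<open>h (u + y)\<close>.\<close>

lemma uniform_convergence_theorem:
  fixes h :: "real \<Rightarrow> real"
  assumes [measurable]: "h \<in> borel_measurable borel"
    and lim: "\<And>t. ((\<lambda>u. h (u + t) - h u) \<longlongrightarrow> 0) at_top"
    and e: "e > 0"
  shows "\<exists>U. \<forall>u\<ge>U. \<forall>t\<in>{0..1}. \<bar>h (u + t) - h u\<bar> < e"
proof -
  \<comment> \<open>For \<open>y\<close> in {1..2} and \<open>t\<close> in {0..1} both
    \<open>y\<close> and \<open>y - t\<close> lie in {0..2}, so one window serves both
    shifts.\<close>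
  define B where "B u = {y. y \<in> {0..2} \<and> \<bar>h (u + y) - h u\<bar> \<ge> e / 2}" for u
  have B [measurable]: "B u \<in> sets borel" for u
    unfolding B_def by measurable
  have B_fm: "B u \<in> fmeasurable lborel" for u
    by (rule fmeasurableI2[of "{0..2}"]) (auto simp: B_def intro: fmeasurableI)
  have "((\<lambda>u. LINT y|lborel. indicator (B u) y) \<longlongrightarrow> (LINT y::real|lborel. (0::real))) at_top"
  proof (rule integral_dominated_convergence_at_top[where w = "indicator {0..2}"])
    show "\<forall>\<^sub>F u in at_top. AE y in lborel. norm (indicator (B u) y :: real) \<le> indicator {0..2} y"
      by (intro always_eventually allI AE_I2) (auto simp: B_def indicator_def)
    show "AE y in lborel. ((\<lambda>u. indicator (B u) y :: real) \<longlongrightarrow> 0) at_top"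
    proof (rule AE_I2)
      fix y
      have "\<forall>\<^sub>F u in at_top. dist (h (u + y) - h u) 0 < e / 2"
        using lim e by (intro tendstoD) auto
      then have "\<forall>\<^sub>F u in at_top. indicator (B u) y = (0::real)"
        by eventually_elim (auto simp: B_def)
      then show "((\<lambda>u. indicator (B u) y :: real) \<longlongrightarrow> 0) at_top"
        by (rule tendsto_eventually)
    qed
  qed auto
  then have "((\<lambda>u. measure lborel (B u)) \<longlongrightarrow> 0) at_top"
    by simp
  then have "\<forall>\<^sub>F u in at_top. dist (measure lborel (B u)) 0 < 1 / 4"
    by (rule tendstoD) simp
  then obtain U where U: "\<And>u. u \<ge> U \<Longrightarrow> measure lborel (B u) < 1 / 4"
    by (auto simp: eventually_at_top_linorder)
  show ?thesis
  proof (intro exI allI impI ballI)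
    fix u t :: real assume u: "U \<le> u" and t: "t \<in> {0..1}"
    define A where "A = (+) t ` B (u + t)"
    have A_eq: "A = (\<lambda>y. y - t) -` B (u + t)"
      unfolding A_def by (auto simp: image_iff) (metis add.commute diff_add_cancel)
    have [measurable]: "A \<in> sets borel"
      unfolding A_eq by (rule measurable_sets_borel[of _ borel]) auto
    have "measure lebesgue A = measure lebesgue (B (u + t))"
      unfolding A_def by (rule measure_translation)
    then have mA: "measure lborel A < 1 / 4"
      using U[of "u + t"] u t by (simp add: measure_completion)
    have "A \<subseteq> {0..3}" using t by (auto simp: A_def B_def)
    then have fA: "A \<in> fmeasurable lborel"
      by (rule fmeasurableI2[rotated]) (auto intro: fmeasurableI)
    \<comment> \<open>Both bad sets are small, so some point of {1..2} is good for u and, shifted by t, for u + t.\<close>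
    have "\<not> {1..2} \<subseteq> B u \<union> A"
    proof
      assume "{1..2} \<subseteq> B u \<union> A"
      then have "measure lborel {1..2::real} \<le> measure lborel (B u \<union> A)"
        using B_fm[of u] fA by (intro measure_mono_fmeasurable) (auto intro: fmeasurable.Un)
      also have "\<dots> \<le> measure lborel (B u) + measure lborel A"
        using B_fm[of u] fA by (intro measure_Un_le) (auto simp: fmeasurable_def)
      also have "\<dots> < 1"
        using mA U[OF u] by simp
      finally show False by simp
    qed
    then obtain y where y: "y \<in> {1..2}" "y \<notin> B u" "y \<notin> A" by blast
    then have "\<bar>h (u + y) - h u\<bar> < e / 2"
      by (auto simp: B_def)
    moreover have "y - t \<notin> B (u + t)" "y - t \<in> {0..2}" using y t by (auto simp: A_eq)
    then have "\<bar>h (u + y) - h (u + t)\<bar> < e / 2" unfolding B_def by auto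
    ultimately show "\<bar>h (u + t) - h u\<bar> < e" unfolding abs_less_iff by linarith
  qed
qed

text \<open>Each unit step costs \<open>e\<close> and the fractional rest costs one more
  \<open>e\<close>. After exponentiation this extra \<open>e\<close> becomes the constant
  \<open>exp e\<close> in Potter's bounds.\<close>

lemma slow_increments_linear_bound:
  fixes h :: "real \<Rightarrow> real"
  assumes U: "\<And>u t. u \<ge> U \<Longrightarrow> t \<in> {0..1} \<Longrightarrow> \<bar>h (u + t) - h u\<bar> \<le> e"
    and u: "u \<ge> U" and t: "t \<ge> 0"
  shows "\<bar>h (u + t) - h u\<bar> \<le> e * (t + 1)"
proof -
  have e: "e \<ge> 0" using U[of U 0] by simp
  have steps: "\<bar>h (u + real n) - h u\<bar> \<le> e * real n" for n
  proof (induction n)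
    case (Suc n)
    have "\<bar>h (u + real n + 1) - h (u + real n)\<bar> \<le> e"
      using u by (intro U) auto
    then show ?case using Suc by (simp add: algebra_simps abs_le_iff)
  qed simp
  define n where "n = nat \<lfloor>t\<rfloor>"
  have n: "real n \<le> t" "t - real n \<in> {0..1}" unfolding n_def using t by (auto; linarith)+
  have "\<bar>h (u + real n + (t - real n)) - h (u + real n)\<bar> \<le> e"
    using u n by (intro U) auto
  then have "\<bar>h (u + t) - h u\<bar> \<le> e * real n + e" using steps[of n] by (simp add: abs_le_iff)
  also have "\<dots> \<le> e * (t + 1)" using mult_left_mono[OF n(1) e] by (simp add: algebra_simps)
  finally show ?thesis .
qed

lemma regvar_Potter:
  assumes g: "regvar a g" and e: "e > 0"
  shows "\<exists>K>0. \<forall>x\<ge>K. g x > 0 \<and> (\<forall>y\<ge>x.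
      exp (- e) * (y / x) powr (a - e) * g x \<le> g y \<and>
      g y \<le> exp e * (y / x) powr (a + e) * g x)"
proof -
  from g have [measurable]: "g \<in> borel_measurable borel" and pos: "\<forall>\<^sub>F x in at_top. g x > 0"
    and lim: "\<And>l. l > 0 \<Longrightarrow> ((\<lambda>x. g (l * x) / g x) \<longlongrightarrow> l powr a) at_top"
    by (auto simp: regvar_def)
  from pos obtain K0 where K0: "\<And>x. x \<ge> K0 \<Longrightarrow> g x > 0"
    by (auto simp: eventually_at_top_linorder)
  \<comment> \<open>In logarithmic coordinates scaling becomes translation, and subtracting
    \<open>a * u\<close> removes the index, so the increments of \<open>h\<close> tend to 0.\<close>
  define h where "h u = ln (g (exp u)) - a * u" for u
  have [measurable]: "h \<in> borel_measurable borel" unfolding h_def by measurable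
  have exp_top: "filterlim (exp :: real \<Rightarrow> real) at_top at_top" by (rule exp_at_top)
  have "((\<lambda>u. h (u + t) - h u) \<longlongrightarrow> 0) at_top" for t
  proof -
    have "((\<lambda>u. g (exp t * exp u) / g (exp u)) \<longlongrightarrow> exp t powr a) at_top"
      using filterlim_compose[OF lim exp_top] by simp
    then have "((\<lambda>u. ln (g (exp t * exp u) / g (exp u)) - a * t) \<longlongrightarrow> ln (exp t powr a) - a * t) at_top"
      by (intro tendsto_intros) auto
    also have "ln (exp t powr a) - a * t = 0" by (simp add: ln_powr)
    finally show ?thesis
    proof (rule Lim_transform_eventually)
      have "\<forall>\<^sub>F u in at_top. g (exp u) > 0"
        using exp_top pos by (rule eventually_compose_filterlim[rotated])
      moreover have "\<forall>\<^sub>F u in at_top. g (exp (u + t)) > 0"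
        by (rule eventually_compose_filterlim[OF pos]) real_asymp
      ultimately show "\<forall>\<^sub>F u in at_top. ln (g (exp t * exp u) / g (exp u)) - a * t = h (u + t) - h u"
        by eventually_elim (simp add: h_def ln_div exp_add algebra_simps)
    qed
  qed
  from uniform_convergence_theorem[OF _ this e] obtain U where
    U: "\<And>u t. u \<ge> U \<Longrightarrow> t \<in> {0..1} \<Longrightarrow> \<bar>h (u + t) - h u\<bar> < e" by fastforce
  define K where "K = max (exp U) (max 1 K0)"
  show ?thesis
  proof (intro exI[of _ K] conjI allI impI)
    show "K > 0" by (simp add: K_def)
    fix x assume x: "K \<le> x"
    then show gx: "g x > 0" using K0 by (auto simp: K_def)
    fix y assume y: "x \<le> y"
    have gy: "g y > 0" using x y K0 by (auto simp: K_def)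
    have xp: "x > 0" "y > 0" using x y by (auto simp: K_def)
    have lx: "ln x \<ge> U" using x xp by (simp add: K_def ln_ge_iff)
    have lxy: "ln (y / x) \<ge> 0" using xp y by simp
    have "\<bar>h (ln x + ln (y / x)) - h (ln x)\<bar> \<le> e * (ln (y / x) + 1)"
      by (rule slow_increments_linear_bound[OF _ lx lxy]) (use U in \<open>auto intro: less_imp_le\<close>)
    moreover have "h (ln x + ln (y / x)) - h (ln x) = ln (g y) - ln (g x) - a * ln (y / x)"
      using xp by (simp add: h_def ln_div algebra_simps)
    ultimately have b: "ln (g x) + (a - e) * ln (y / x) - e \<le> ln (g y)"
      "ln (g y) \<le> ln (g x) + (a + e) * ln (y / x) + e"
      by (auto simp: abs_le_iff algebra_simps)
    from b(1) have "exp (ln (g x) + (a - e) * ln (y / x) - e) \<le> exp (ln (g y))" by simp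
    then show "exp (- e) * (y / x) powr (a - e) * g x \<le> g y"
      using xp gx gy by (simp add: powr_def exp_add exp_diff exp_minus field_simps)
    from b(2) have "exp (ln (g y)) \<le> exp (ln (g x) + (a + e) * ln (y / x) + e)" by simp
    then show "g y \<le> exp e * (y / x) powr (a + e) * g x"
      using xp gx gy by (simp add: powr_def exp_add field_simps)
  qed
qed

lemma regvar_growth:
  assumes g: "regvar a g" and b: "b < a"
  shows "filterlim (\<lambda>x. g x / x powr b) at_top at_top"
proof -
  \<comment> \<open>Half the gap, so that Potter's exponent \<open>a - e\<close> equals
    \<open>b + e\<close> and a surplus power \<open>e\<close> remains.\<close>
  define e where "e = (a - b) / 2"
  have e: "e > 0" using b by (simp add: e_def)
  from regvar_Potter[OF g e] obtain K where K: "K > 0" "g K > 0"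
    "\<And>y. y \<ge> K \<Longrightarrow> exp (- e) * (y / K) powr (a - e) * g K \<le> g y" by blast
  define c where "c = exp (- e) * K powr (- (a - e)) * g K"
  have c: "c > 0" using K by (simp add: c_def)
  have "filterlim (\<lambda>y. c * y powr e) at_top at_top"
    using c e by real_asymp
  then show ?thesis
  proof (rule filterlim_at_top_mono)
    show "\<forall>\<^sub>F y in at_top. c * y powr e \<le> g y / y powr b"
      using eventually_ge_at_top[of K]
    proof eventually_elim
      case (elim y)
      then have y: "y > 0" using K by simp
      have "c * y powr e * y powr b = c * y powr (a - e)"
        using y by (simp add: e_def field_simps flip: powr_add)
      also have "\<dots> = exp (- e) * (y / K) powr (a - e) * g K"
        using K y by (simp add: c_def powr_divide powr_minus[of K "a - e"] divide_simps del: minus_diff_eq)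
      also have "\<dots> \<le> g y" using K(3) elim .
      finally show ?case using y by (simp add: pos_le_divide_eq)
    qed
  qed
qed

lemma regvar_at_top:
  assumes "regvar a g" "a > 0"
  shows "filterlim g at_top at_top"
proof -
  have "filterlim (\<lambda>x. g x / x powr 0) at_top at_top" using assms by (rule regvar_growth)
  then show ?thesis
    by (rule filterlim_at_top_mono) (use eventually_gt_at_top[of 0] in \<open>eventually_elim, simp\<close>)
qed

text \<open>An index below 1 would make \<open>g\<close> sublinear by Potter's upper bound; with
  \<open>e\<close> half of \<open>1 - a\<close> the exponent there is
  \<open>a + e = 1 - e\<close>.\<close>

lemma regvar_index_ge:
  assumes g: "regvar a g" and c: "c > 0" and lower: "\<forall>\<^sub>F x in at_top. c * x \<le> g x"
  shows "a \<ge> 1"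
proof (rule ccontr)
  assume "\<not> a \<ge> 1"
  define e where "e = (1 - a) / 2"
  have e: "e > 0" using \<open>\<not> a \<ge> 1\<close> by (simp add: e_def)
  from regvar_Potter[OF g e] obtain K where K: "K > 0" "g K > 0"
    "\<And>y. y \<ge> K \<Longrightarrow> g y \<le> exp e * (y / K) powr (a + e) * g K" by blast
  have "\<forall>\<^sub>F y in at_top. exp e * (y / K) powr (1 - e) * g K < c * y"
    using e K(1,2) c by real_asymp
  moreover have "a + e = 1 - e" by (simp add: e_def field_simps)
  ultimately have "\<forall>\<^sub>F y in at_top. exp e * (y / K) powr (a + e) * g K < c * y" by (simp only:)
  with lower eventually_ge_at_top[of K]
  have "\<forall>\<^sub>F y in at_top. K \<le> y \<and> exp e * (y / K) powr (a + e) * g K < g y"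
    by eventually_elim linarith
  then obtain y where "K \<le> y" "exp e * (y / K) powr (a + e) * g K < g y"
    using eventually_happens'[of "at_top :: real filter"] by force
  then show False using K(3)[of y] by linarith
qed

lemma regvar_asymp_equiv:
  assumes g: "regvar a g" and eq: "g \<sim>[at_top] g'" and m: "g' \<in> borel_measurable borel"
  shows "regvar a g'"
  unfolding regvar_def
proof (intro conjI allI impI)
  from g have pos: "\<forall>\<^sub>F x in at_top. g x > 0"
    and lim: "\<And>l. l > 0 \<Longrightarrow> ((\<lambda>x. g (l * x) / g x) \<longlongrightarrow> l powr a) at_top"
    by (auto simp: regvar_def)
  show "\<forall>\<^sub>F x in at_top. g' x > 0"
    using asymp_equiv_imp_eventually_same_sign[OF eq] pos
    by eventually_elim (auto simp: sgn_if split: if_splits)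
  fix l :: real assume l: "l > 0"
  have "(\<lambda>x. g (l * x) / g x) \<sim>[at_top] (\<lambda>x. g' (l * x) / g' x)"
    using l by (intro asymp_equiv_divide eq asymp_equiv_compose'[OF eq]) real_asymp
  then show "((\<lambda>x. g' (l * x) / g' x) \<longlongrightarrow> l powr a) at_top"
    using lim[OF l] asymp_equiv_tendsto_transfer by blast
qed (rule m)

section \<open>Subtracting the identity\<close>

text \<open>For index above 1 the subtracted \<open>x\<close> is negligible. For index 1 it is not,
  and \<open>x / g x\<close> may oscillate; what saves the limit is that \<open>g\<close> and the
  identity then have the same index, while \<open>1 - x / g x\<close> stays above
  \<open>d / (1 + d)\<close>.\<close>

lemma regvar_minus_id:
  assumes g: "regvar a g" and d: "d > 0" and lower: "\<forall>\<^sub>F x in at_top. (1 + d) * x \<le> g x"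
  shows "regvar a (\<lambda>x. g x - x)"
  unfolding regvar_def
proof (intro conjI allI impI)
  from g have [measurable]: "g \<in> borel_measurable borel"
    and lim: "\<And>l. l > 0 \<Longrightarrow> ((\<lambda>x. g (l * x) / g x) \<longlongrightarrow> l powr a) at_top"
    by (auto simp: regvar_def)
  show "(\<lambda>x. g x - x) \<in> borel_measurable borel" by measurable
  have bounds: "\<forall>\<^sub>F x in at_top. 0 < x \<and> 0 < g x \<and> x < g x \<and> x / g x \<le> 1 / (1 + d)"
    using lower eventually_gt_at_top[of 0]
  proof eventually_elim
    case (elim x)
    have "0 < d * x" using d elim by simp
    with elim have x: "0 < x" "x < g x" by (auto simp: algebra_simps)
    then show ?case using elim d by (auto simp: field_simps)
  qed
  then show "\<forall>\<^sub>F x in at_top. g x - x > 0" by eventually_elim simp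
  fix l :: real assume l: "l > 0"
  have rewr: "\<forall>\<^sub>F x in at_top. (g (l * x) / g x - l * (x / g x)) / (1 - x / g x) = (g (l * x) - l * x) / (g x - x)"
    using bounds by eventually_elim (simp add: field_simps)
  have "a \<ge> 1"
    using regvar_index_ge[OF g, of "1 + d"] d lower by simp
  then consider "a > 1" | "a = 1" by linarith
  then have "((\<lambda>x. (g (l * x) / g x - l * (x / g x)) / (1 - x / g x)) \<longlongrightarrow> l powr a) at_top"
  proof cases
    case 1
    have "((\<lambda>x. inverse (g x / x powr 1)) \<longlongrightarrow> 0) at_top"
      by (rule tendsto_inverse_0_at_top[OF regvar_growth[OF g 1]])
    then have "((\<lambda>x. x / g x) \<longlongrightarrow> 0) at_top"
      by (rule Lim_transform_eventually) (use eventually_gt_at_top[of 0] in \<open>eventually_elim, simp\<close>)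
    then have "((\<lambda>x. (g (l * x) / g x - l * (x / g x)) / (1 - x / g x)) \<longlongrightarrow> (l powr a - l * 0) / (1 - 0)) at_top"
      by (intro tendsto_intros lim l) auto
    then show ?thesis by simp
  next
    case 2
    \<comment> \<open>With \<open>u = g (l * x) / g x\<close> and \<open>q = x / g x\<close>, the
      quotient is \<open>(u - l * q) / (1 - q) = l + (u - l) / (1 - q)\<close>. The last term
      vanishes without any convergence of \<open>q\<close>.\<close>
    have "((\<lambda>x. g (l * x) / g x - l) \<longlongrightarrow> l powr a - l) at_top"
      by (intro tendsto_intros lim l)
    then have "((\<lambda>x. \<bar>g (l * x) / g x - l\<bar> * ((1 + d) / d)) \<longlongrightarrow> 0) at_top"
      using 2 l by (intro tendsto_mult_left_zero tendsto_rabs_zero) auto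
    then have "((\<lambda>x. (g (l * x) / g x - l) / (1 - x / g x)) \<longlongrightarrow> 0) at_top"
    proof (rule Lim_null_comparison[rotated])
      show "\<forall>\<^sub>F x in at_top. norm ((g (l * x) / g x - l) / (1 - x / g x)) \<le> \<bar>g (l * x) / g x - l\<bar> * ((1 + d) / d)"
        using bounds
      proof eventually_elim
        case (elim x)
        moreover have "d / (1 + d) = 1 - 1 / (1 + d)" using d by (simp add: field_simps)
        ultimately have "d / (1 + d) \<le> 1 - x / g x" by linarith
        moreover have "0 < d / (1 + d)" using d by simp
        ultimately have "1 / (1 - x / g x) \<le> 1 / (d / (1 + d))" "1 - x / g x > 0"
          by (auto intro!: divide_left_mono mult_pos_pos simp del: divide_divide_eq_right)
        then show ?case
          using mult_left_mono[of "1 / (1 - x / g x)" "(1 + d) / d" "\<bar>g (l * x) / g x - l\<bar>"]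
          by (simp add: abs_divide)
      qed
    qed
    then have "((\<lambda>x. l + (g (l * x) / g x - l) / (1 - x / g x)) \<longlongrightarrow> l + 0) at_top"
      by (intro tendsto_intros)
    moreover have "\<forall>\<^sub>F x in at_top. l + (g (l * x) / g x - l) / (1 - x / g x) =
        (g (l * x) / g x - l * (x / g x)) / (1 - x / g x)"
      using bounds
    proof eventually_elim
      case (elim x)
      then have "1 - x / g x \<noteq> 0" by simp
      then show ?case by (simp add: field_simps)
    qed
    ultimately show ?thesis using 2 l by (auto intro: Lim_transform_eventually)
  qed
  then show "((\<lambda>x. (g (l * x) - l * x) / (g x - x)) \<longlongrightarrow> l powr a) at_top"
    using rewr by (rule Lim_transform_eventually)
qed

lemma asymp_equiv_minus_id:
  fixes g G :: "real \<Rightarrow> real"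
  assumes eq: "g \<sim>[at_top] G" and d: "d > 0" and lower: "\<forall>\<^sub>F k in at_top. (1 + d) * k \<le> G k"
  shows "(\<lambda>k. g k - k) \<sim>[at_top] (\<lambda>k. G k - k)"
proof (rule asymp_equivI')
  have bounds: "\<forall>\<^sub>F k in at_top. 0 < k \<and> (1 + d) * k \<le> G k \<and> 0 < G k \<and> 0 < G k - k"
    using lower eventually_gt_at_top[of 0]
  proof eventually_elim
    case (elim k)
    have "0 < d * k" using d elim by simp
    with elim show ?case by (auto simp: algebra_simps)
  qed
  have "((\<lambda>k. g k / G k - 1) \<longlongrightarrow> 1 - 1) at_top"
    by (intro tendsto_intros asymp_equivD_strong[OF eq] eventually_mono[OF bounds]) auto
  then have "((\<lambda>k. \<bar>g k / G k - 1\<bar> * ((1 + d) / d)) \<longlongrightarrow> 0) at_top"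
    by (intro tendsto_mult_left_zero tendsto_rabs_zero) simp
  then have "((\<lambda>k. (g k - k) / (G k - k) - 1) \<longlongrightarrow> 0) at_top"
  proof (rule Lim_null_comparison[rotated])
    show "\<forall>\<^sub>F k in at_top. norm ((g k - k) / (G k - k) - 1) \<le> \<bar>g k / G k - 1\<bar> * ((1 + d) / d)"
      using bounds
    proof eventually_elim
      case (elim k)
      \<comment> \<open>Subtracting \<open>k\<close> amplifies the relative error by
        \<open>G k / (G k - k)\<close>, which the linear lower bound keeps below
        \<open>(1 + d) / d\<close>.\<close>
      have "(g k - k) / (G k - k) - 1 = (g k / G k - 1) * (G k / (G k - k))"
        using elim by (simp add: field_simps)
      then have "norm ((g k - k) / (G k - k) - 1) = \<bar>g k / G k - 1\<bar> * (G k / (G k - k))"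
        using elim by (simp add: abs_mult)
      also have "G k / (G k - k) \<le> (1 + d) / d"
        using elim d by (simp add: field_simps)
      finally show ?case by (simp add: mult_left_mono)
    qed
  qed
  then show "((\<lambda>k. (g k - k) / (G k - k)) \<longlongrightarrow> 1) at_top"
    by (rule LIM_zero_cancel)
qed

section \<open>Black--Scholes prices\<close>

lemma sqrt_sum_pos: "x \<ge> 0 \<Longrightarrow> sqrt x + sqrt (x + 1) > 0"
  by (intro add_nonneg_pos) auto

text \<open>The defining difference cancels for large arguments. The rationalized form does not, and
  monotonicity and scaling can be read off its denominator.\<close>

lemma psi_eq:
  assumes "x \<ge> 0"
  shows "psi x = 2 / (sqrt x + sqrt (x + 1))\<^sup>2"
proof -
  have "(sqrt (x + 1) - sqrt x) * (sqrt x + sqrt (x + 1)) = 1"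
    using assms by (simp add: algebra_simps flip: power2_eq_square)
  moreover have "sqrt x + sqrt (x + 1) > 0"
    using assms by (intro add_nonneg_pos) auto
  ultimately have "sqrt (x + 1) - sqrt x = 1 / (sqrt x + sqrt (x + 1))"
    by (simp add: field_simps)
  then have "2 / (sqrt x + sqrt (x + 1))\<^sup>2 = 2 * (sqrt (x + 1) - sqrt x)\<^sup>2"
    by (simp add: power_divide)
  also have "\<dots> = psi x"
    using assms by (simp add: psi_def power2_diff real_sqrt_mult[symmetric] algebra_simps power2_eq_square)
  finally show ?thesis ..
qed

lemma psi_pos: "x \<ge> 0 \<Longrightarrow> psi x > 0"
  using sqrt_sum_pos[of x] by (simp add: psi_eq)

lemma psi_antimono: "0 \<le> x \<Longrightarrow> x \<le> y \<Longrightarrow> psi y \<le> psi x"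
  by (auto simp: psi_eq add_nonneg_pos intro!: divide_left_mono power_mono add_mono mult_pos_pos zero_less_power)

text \<open>A crude bound, used to keep the implied volatility from being smaller than a power of
  the log price.\<close>

lemma psi_ge:
  assumes "x \<ge> 0"
  shows "psi x \<ge> 1 / (2 * (x + 1))"
proof -
  have "(sqrt x + sqrt (x + 1))\<^sup>2 \<le> (2 * sqrt (x + 1))\<^sup>2"
    using assms by (intro power_mono) auto
  then have "2 / (2 * sqrt (x + 1))\<^sup>2 \<le> psi x"
    unfolding psi_eq[OF assms] using assms
    by (intro divide_left_mono mult_pos_pos zero_less_power sqrt_sum_pos) auto
  then show ?thesis using assms by (simp add: power_mult_distrib field_simps)
qed

text \<open>Since \<open>l * x + 1 \<ge> l * (x + 1)\<close>, scaling the argument by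
  \<open>l\<close> shrinks the denominator in \<open>psi_eq\<close> by a factor no smaller than
  \<open>l\<close>.\<close>

lemma psi_scale:
  assumes "0 < l" "l \<le> 1" "0 < x"
  shows "psi (l * x) \<le> psi x / l"
proof -
  have "sqrt l * sqrt (x + 1) \<le> sqrt (l * x + 1)"
    using assms by (auto simp flip: real_sqrt_mult simp: algebra_simps)
  then have "(sqrt l * (sqrt x + sqrt (x + 1)))\<^sup>2 \<le> (sqrt (l * x) + sqrt (l * x + 1))\<^sup>2"
    using assms by (intro power_mono) (auto simp: real_sqrt_mult algebra_simps)
  also have "(sqrt l * (sqrt x + sqrt (x + 1)))\<^sup>2 = l * (sqrt x + sqrt (x + 1))\<^sup>2"
    using assms by (simp add: power_mult_distrib)
  finally have "2 / (sqrt (l * x) + sqrt (l * x + 1))\<^sup>2 \<le> 2 / (l * (sqrt x + sqrt (x + 1))\<^sup>2)"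
    using assms by (intro divide_left_mono mult_pos_pos zero_less_power sqrt_sum_pos) auto
  then show ?thesis
    using assms by (simp add: psi_eq mult.commute)
qed

text \<open>Antitonicity and \<open>psi_scale\<close> trap the quotient of the values between 1 and
  \<open>g x / f x\<close>, so the arguments need not converge or stay bounded.\<close>

lemma psi_asymp_equiv:
  assumes eq: "f \<sim>[F] g" and f: "\<forall>\<^sub>F x in F. f x > 0" and g: "\<forall>\<^sub>F x in F. g x > 0"
  shows "(\<lambda>x. psi (f x)) \<sim>[F] (\<lambda>x. psi (g x))"
proof (rule asymp_equivI')
  have lim: "((\<lambda>x. g x / f x) \<longlongrightarrow> 1) F"
    by (rule asymp_equivD_strong[OF asymp_equiv_symI[OF eq]]) (use f in \<open>auto elim: eventually_mono\<close>)
  have b: "\<forall>\<^sub>F x in F. min 1 (g x / f x) \<le> psi (f x) / psi (g x) \<and> psi (f x) / psi (g x) \<le> max 1 (g x / f x)"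
    using f g
  proof eventually_elim
    case (elim x)
    have p: "psi (f x) > 0" "psi (g x) > 0" using elim by (auto intro!: psi_pos)
    show ?case
    proof (cases "f x \<le> g x")
      case True
      then have "psi (f x) \<le> psi (g x) / (f x / g x)" "psi (g x) \<le> psi (f x)"
        using psi_scale[of "f x / g x" "g x"] psi_antimono[of "f x" "g x"] elim by auto
      then show ?thesis using p elim by (auto simp: field_simps min_le_iff_disj le_max_iff_disj)
    next
      case False
      then have "psi (g x) \<le> psi (f x) / (g x / f x)" "psi (f x) \<le> psi (g x)"
        using psi_scale[of "g x / f x" "f x"] psi_antimono[of "g x" "f x"] elim by auto
      then show ?thesis using p elim by (auto simp: field_simps min_le_iff_disj le_max_iff_disj)
    qed
  qed
  show "((\<lambda>x. psi (f x) / psi (g x)) \<longlongrightarrow> 1) F"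
  proof (rule tendsto_sandwich)
    show "((\<lambda>x. min 1 (g x / f x)) \<longlongrightarrow> 1) F" "((\<lambda>x. max 1 (g x / f x)) \<longlongrightarrow> 1) F"
      using tendsto_min[OF tendsto_const[of 1] lim] tendsto_max[OF tendsto_const[of 1] lim] by simp_all
  qed (use b in \<open>auto elim: eventually_mono\<close>)
qed

lemma psi_at_top: "psi \<sim>[at_top] (\<lambda>x. 1 / (2 * x))"
  unfolding psi_def by real_asymp

section \<open>The normal distribution function\<close>

lemma Phi_eq_cdf: "Phi = cdf std_normal_distribution"
proof
  fix x
  have "cdf std_normal_distribution x = (LINT t|std_normal_distribution. indicator {..x} t)"
    by (simp add: cdf_def)
  also have "\<dots> = Phi x"
    by (subst integral_density) (auto simp: Phi_def set_lebesgue_integral_def mult.commute)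
  finally show "Phi x = cdf std_normal_distribution x" ..
qed

lemma Phi_nonneg: "0 \<le> Phi x"
  by (simp add: Phi_eq_cdf cdf_def)

lemma Phi_at_top: "(Phi \<longlongrightarrow> 1) at_top"
  unfolding Phi_eq_cdf by (rule real_distribution.cdf_lim_at_top_prob[OF real_dist_normal_dist])

lemma Phi_at_bot: "(Phi \<longlongrightarrow> 0) at_bot"
  unfolding Phi_eq_cdf
  by (rule finite_borel_measure.cdf_lim_at_bot[OF real_distribution.finite_borel_measure_M[OF real_dist_normal_dist]])

lemma Phi_has_derivative: "(Phi has_real_derivative std_normal_density x) (at x)"
proof -
  have int: "set_integrable lborel A std_normal_density" if "A \<in> sets borel" for A
    using that unfolding set_integrable_def by (intro integrable_mult_indicator integrable_normal_density) auto
  have "((\<lambda>u. LBINT y=x-1..u. std_normal_density y) has_vector_derivative std_normal_density x)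
      (at x within {x-1..x+1})"
    by (rule interval_integral_FTC2) (auto intro!: continuous_intros simp: std_normal_density_def)
  then have "((\<lambda>u. Phi (x - 1) + (LBINT y=x-1..u. std_normal_density y)) has_vector_derivative std_normal_density x)
      (at x within {x-1..x+1})"
    by (auto intro!: derivative_eq_intros)
  moreover have "Phi (x - 1) + (LBINT y=x-1..u. std_normal_density y) = Phi u" if "u \<in> {x-1..x+1}" for u
  proof -
    have "{..u} = {..x-1} \<union> {x-1<..u}" using that by auto
    then show ?thesis
      using that by (simp add: Phi_def interval_integral_Ioc set_integral_Un int ivl_disj_int)
  qed
  ultimately have "(Phi has_vector_derivative std_normal_density x) (at x within {x-1..x+1})"
    by (subst (asm) has_vector_derivative_cong_ev) auto
  moreover have "at x within {x-1..x+1} = at x"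
    by (rule at_within_interior) auto
  ultimately show ?thesis
    by (simp add: has_real_derivative_iff_has_vector_derivative)
qed

text \<open>Exponential tilting: for \<open>t \<le> - D\<close> one has
  \<open>t\<^sup>2 \<ge> D\<^sup>2 + (t + D)\<^sup>2\<close>, so the density is below
  \<open>exp (- D\<^sup>2 / 2)\<close> times the normal density centred at \<open>- D\<close>, whose
  total mass is 1.\<close>

lemma Phi_Chernoff:
  assumes "D \<ge> 0"
  shows "Phi (- D) \<le> exp (- D\<^sup>2 / 2)"
proof -
  have "Phi (- D) \<le> (LINT t|lborel. exp (- D\<^sup>2 / 2) * normal_density (- D) 1 t)"
    unfolding Phi_def set_lebesgue_integral_def
  proof (rule integral_mono)
    show "integrable lborel (\<lambda>t. indicator {..- D} t *\<^sub>R std_normal_density t)"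
      by (intro integrable_mult_indicator integrable_normal_density) auto
    show "integrable lborel (\<lambda>t. exp (- D\<^sup>2 / 2) * normal_density (- D) 1 t)"
      by (intro integrable_mult_right integrable_normal_density) auto
    fix t
    have "exp (- t\<^sup>2 / 2) \<le> exp (- D\<^sup>2 / 2) * exp (- (t + D)\<^sup>2 / 2)" if "t \<le> - D"
    proof -
      have "D * t \<le> D * (- D)" using that assms by (rule mult_left_mono)
      then have "- t\<^sup>2 / 2 \<le> - D\<^sup>2 / 2 + - (t + D)\<^sup>2 / 2"
        by (simp add: power2_eq_square field_simps)
      then show ?thesis by (simp flip: exp_add)
    qed
    then show "indicator {..- D} t *\<^sub>R std_normal_density t \<le> exp (- D\<^sup>2 / 2) * normal_density (- D) 1 t"
      by (auto simp: indicator_def normal_density_def field_simps)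
  qed
  also have "\<dots> = exp (- D\<^sup>2 / 2)" by simp
  finally show ?thesis .
qed

section \<open>The price as a function of volatility\<close>

text \<open>The squares of \<open>d\<^sub>2\<close> and \<open>d\<^sub>1\<close> differ by
  \<open>2 * k\<close>. This makes the two contributions \<open>k / s\<^sup>2\<close> to the vega
  cancel.\<close>

lemma std_normal_density_d2:
  assumes "s > 0"
  shows "exp k * std_normal_density (- k / s - s / 2) = std_normal_density (- k / s + s / 2)"
proof -
  have "k + - (- k / s - s / 2)\<^sup>2 / 2 = - (- k / s + s / 2)\<^sup>2 / 2"
    using assms by (simp add: power2_eq_square field_simps)
  then have "exp k * exp (- (- k / s - s / 2)\<^sup>2 / 2) = exp (- (- k / s + s / 2)\<^sup>2 / 2)"
    by (simp flip: exp_add)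
  then show ?thesis by (simp add: std_normal_density_def)
qed

lemma cBS_vega:
  assumes "s > 0"
  shows "(cBS k has_real_derivative std_normal_density (- k / s + s / 2)) (at s)"
proof -
  have "((\<lambda>s. Phi (- k / s + s / 2) - exp k * Phi (- k / s - s / 2)) has_real_derivative
      std_normal_density (- k / s + s / 2) * (k / s\<^sup>2 + 1 / 2)
      - exp k * (std_normal_density (- k / s - s / 2) * (k / s\<^sup>2 - 1 / 2))) (at s)"
    using assms by (auto intro!: derivative_eq_intros DERIV_chain2[OF Phi_has_derivative] simp: power2_eq_square)
  also have "std_normal_density (- k / s + s / 2) * (k / s\<^sup>2 + 1 / 2)
      - exp k * (std_normal_density (- k / s - s / 2) * (k / s\<^sup>2 - 1 / 2)) =
      std_normal_density (- k / s + s / 2)"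
    using std_normal_density_d2[OF assms, of k] by (simp only: mult.assoc[symmetric]) (simp add: algebra_simps)
  finally show ?thesis by (simp add: cBS_def[abs_def])
qed

lemma cBS_strict_mono:
  assumes "0 < s" "s < t"
  shows "cBS k s < cBS k t"
  using assms(2)
  by (rule DERIV_pos_imp_increasing) (use assms in \<open>auto intro!: exI cBS_vega normal_density_pos\<close>)

lemma cBS_at_0:
  assumes "k > 0"
  shows "(cBS k \<longlongrightarrow> 0) (at_right 0)"
proof -
  have "filterlim (\<lambda>s. - k / s + s / 2) at_bot (at_right 0)" "filterlim (\<lambda>s. - k / s - s / 2) at_bot (at_right 0)"
    using assms by real_asymp+
  then have "((\<lambda>s. Phi (- k / s + s / 2) - exp k * Phi (- k / s - s / 2)) \<longlongrightarrow> 0 - exp k * 0) (at_right 0)"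
    by (intro tendsto_intros filterlim_compose[OF Phi_at_bot])
  then show ?thesis by (simp add: cBS_def[abs_def])
qed

lemma cBS_at_top: "(cBS k \<longlongrightarrow> 1) at_top"
proof -
  have "filterlim (\<lambda>s. - k / s + s / 2) at_top at_top" "filterlim (\<lambda>s. - k / s - s / 2) at_bot at_top"
    by real_asymp+
  then have "((\<lambda>s. Phi (- k / s + s / 2) - exp k * Phi (- k / s - s / 2)) \<longlongrightarrow> 1 - exp k * 0) at_top"
    by (intro tendsto_intros filterlim_compose[OF Phi_at_bot] filterlim_compose[OF Phi_at_top])
  then show ?thesis by (simp add: cBS_def[abs_def])
qed

lemma cBS_nonneg:
  assumes "k > 0" "s > 0"
  shows "0 \<le> cBS k s"
proof (rule tendsto_upperbound[OF cBS_at_0[OF assms(1)]])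
  show "\<forall>\<^sub>F t in at_right 0. cBS k t \<le> cBS k s"
    using assms by (auto simp: eventually_at_right_field intro!: exI[of _ s] less_imp_le cBS_strict_mono)
qed simp

text \<open>Justifies the \<open>THE\<close> in \<open>impvol\<close>: for positive \<open>k\<close>
  the price increases strictly and continuously from 0 to 1, so each value strictly between is
  attained exactly once.\<close>

lemma impvol_unique_solution:
  assumes k: "k > 0" and c: "0 < callp M k" "callp M k < 1"
  shows "impvol M k > 0" "cBS k (impvol M k) = callp M k"
proof -
  have "\<forall>\<^sub>F s in at_right 0. cBS k s < callp M k"
    using cBS_at_0[OF k] c by (intro order_tendstoD)
  then obtain b where b: "b > 0" "\<And>s. 0 < s \<Longrightarrow> s < b \<Longrightarrow> cBS k s < callp M k"
    by (auto simp: eventually_at_right_field)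
  have "\<forall>\<^sub>F s in at_top. cBS k s > callp M k"
    using cBS_at_top c by (intro order_tendstoD)
  then obtain t where t: "\<And>s. s \<ge> t \<Longrightarrow> cBS k s > callp M k"
    by (auto simp: eventually_at_top_linorder)
  have "\<exists>s. b / 2 \<le> s \<and> s \<le> max b t \<and> cBS k s = callp M k"
  proof (rule IVT)
    show "\<forall>s. b / 2 \<le> s \<and> s \<le> max b t \<longrightarrow> isCont (cBS k) s"
      using b by (auto intro!: DERIV_isCont[OF cBS_vega])
  qed (use b(1) b(2)[of "b / 2"] t[of "max b t"] in auto)
  then obtain s where s: "b / 2 \<le> s" "cBS k s = callp M k" by blast
  then have "s > 0" using b by simp
  have "\<exists>!s. s > 0 \<and> cBS k s = callp M k"
  proof (rule ex1I[of _ s])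
    fix u assume "u > 0 \<and> cBS k u = callp M k"
    then show "u = s"
      using s \<open>s > 0\<close> cBS_strict_mono[of s u k] cBS_strict_mono[of u s k] by (cases u s rule: linorder_cases) auto
  qed (use s \<open>s > 0\<close> in auto)
  from theI'[OF this] show "impvol M k > 0" "cBS k (impvol M k) = callp M k"
    by (auto simp: impvol_def)
qed

text \<open>The subtracted term of the price is dropped. The bound on \<open>s\<^sup>2\<close> says
  that \<open>- d\<^sub>1\<close> is nonnegative, as Chernoff's bound requires.\<close>

lemma cBS_upper:
  assumes "k > 0" "s > 0" "s\<^sup>2 \<le> 2 * k"
  shows "cBS k s \<le> exp (- (k / s - s / 2)\<^sup>2 / 2)"
proof -
  have "k / s - s / 2 \<ge> 0" using assms by (simp add: field_simps power2_eq_square)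
  from Phi_Chernoff[OF this] have "Phi (- k / s + s / 2) \<le> exp (- (k / s - s / 2)\<^sup>2 / 2)" by simp
  moreover have "0 \<le> exp k * Phi (- k / s - s / 2)" by (simp add: Phi_nonneg)
  ultimately show ?thesis unfolding cBS_def by linarith
qed

text \<open>By the mean value theorem the price gains at least the length of the interval times the
  smallest vega. Below \<open>sqrt (2 * k)\<close> the quantity \<open>- d\<^sub>1\<close> is
  nonnegative and decreasing in the volatility, so the vega is smallest at the left end
  \<open>s\<close>.\<close>

lemma cBS_lower:
  assumes "k > 0" "0 < s" "s < t" "t\<^sup>2 \<le> 2 * k"
  shows "(t - s) * std_normal_density (k / s - s / 2) \<le> cBS k t"
proof -
  have "\<exists>z. s < z \<and> z < t \<and> cBS k t - cBS k s = (t - s) * std_normal_density (- k / z + z / 2)"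
    using assms by (intro MVT2 cBS_vega) auto
  then obtain z where z: "s < z" "z < t" "cBS k t - cBS k s = (t - s) * std_normal_density (- k / z + z / 2)"
    by blast
  have "z\<^sup>2 \<le> t\<^sup>2" using z assms by (intro power_mono) auto
  then have "0 \<le> k / z - z / 2" using z assms by (simp add: field_simps power2_eq_square)
  moreover have "k / z \<le> k / s" using z assms by (intro divide_left_mono) auto
  then have "k / z - z / 2 \<le> k / s - s / 2" using z by simp
  ultimately have "(k / z - z / 2)\<^sup>2 \<le> (k / s - s / 2)\<^sup>2" by (intro power_mono)
  moreover have "(- k / z + z / 2)\<^sup>2 = (k / z - z / 2)\<^sup>2" by (simp add: power2_eq_square algebra_simps)
  ultimately have "std_normal_density (k / s - s / 2) \<le> std_normal_density (- k / z + z / 2)"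
    by (simp add: std_normal_density_def divide_right_mono)
  then have "(t - s) * std_normal_density (k / s - s / 2) \<le> cBS k t - cBS k s"
    unfolding z(3) using assms by (intro mult_left_mono) auto
  then show ?thesis using cBS_nonneg[of k s] assms by linarith
qed

text \<open>With \<open>D = - d\<^sub>1\<close>, the relation between \<open>D\<close> and \<open>s\<close> is inverted exactly by \<^const>\<open>psi\<close>.\<close>

lemma variance_eq_psi:
  assumes "k > 0" "s > 0" "s\<^sup>2 \<le> 2 * k"
  shows "s\<^sup>2 / k = psi ((k / s - s / 2)\<^sup>2 / (2 * k))"
proof -
  define x where "x = (k / s - s / 2)\<^sup>2 / (2 * k)"
  have "k / s - s / 2 \<ge> 0" using assms by (simp add: field_simps power2_eq_square)
  then have 1: "sqrt x = (k / s - s / 2) / sqrt (2 * k)" by (simp add: x_def real_sqrt_divide)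
  \<comment> \<open>Adding 1 to \<open>x\<close> replaces \<open>- d\<^sub>1\<close> by
    \<open>- d\<^sub>2\<close>; in the sum of the two roots the terms \<open>s / 2\<close> then
    cancel.\<close>
  have "x + 1 = (k / s + s / 2)\<^sup>2 / (2 * k)"
    using assms by (simp add: x_def power2_eq_square field_simps)
  then have 2: "sqrt (x + 1) = (k / s + s / 2) / sqrt (2 * k)"
    using assms by (simp add: real_sqrt_divide)
  have "sqrt x + sqrt (x + 1) = 2 * k / s / sqrt (2 * k)"
    unfolding 1 2 by (simp flip: add_divide_distrib)
  moreover have "x \<ge> 0" using assms by (simp add: x_def)
  ultimately have "psi x = 2 / (2 * k / s / sqrt (2 * k))\<^sup>2" by (simp add: psi_eq)
  also have "\<dots> = s\<^sup>2 / k" using assms by (simp add: power_divide power_mult_distrib field_simps power2_eq_square)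
  finally show ?thesis by (simp add: x_def)
qed

section \<open>Asymptotic inversion of the price\<close>

lemma implied_variance_asymp:
  fixes c V :: "real \<Rightarrow> real"
  assumes e: "e > 0"
    and V: "\<forall>\<^sub>F k in at_top. V k > 0 \<and> cBS k (V k) = c k"
    and c_pos: "\<forall>\<^sub>F k in at_top. 0 < c k"
    and c_le: "\<forall>\<^sub>F k in at_top. c k \<le> exp (- e * k)"
  shows "(\<lambda>k. (V k)\<^sup>2 / k) \<sim>[at_top] (\<lambda>k. psi (- ln (c k) / k))"
proof (rule asymp_equivI')
  define L where "L k = - ln (c k)" for k
  have L_ge: "\<forall>\<^sub>F k in at_top. e * k \<le> L k"
    using c_pos c_le
  proof eventually_elim
    case (elim k)
    then have "ln (c k) \<le> ln (exp (- e * k))" by (subst ln_le_cancel_iff) auto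
    then show ?case by (simp add: L_def)
  qed
  have L_top: "filterlim L at_top at_top"
    by (rule filterlim_at_top_mono[OF _ L_ge]) (use e in real_asymp)
  \<comment> \<open>For \<open>t = sqrt (2 * k)\<close>, the value of \<open>- d\<^sub>1\<close> at
    volatility \<open>t - 1\<close> is \<open>1 + 1 / (2 * (t - 1))\<close>, which is at most 3/2
    once \<open>t \<ge> 2\<close>, that is, \<open>k \<ge> 2\<close>.\<close>
  have "\<forall>\<^sub>F k in at_top. exp (- e * k) < std_normal_density (3 / 2)"
    using e by (intro order_tendstoD(2)[where y = 0]) (real_asymp, simp add: normal_density_pos)
  with V c_le have V_less: "\<forall>\<^sub>F k in at_top. (V k)\<^sup>2 < 2 * k"
    using eventually_ge_at_top[of 2]
  proof eventually_elim
    case (elim k)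
    show ?case
    proof (rule ccontr)
      \<comment> \<open>Otherwise the price stays above a constant, because the vega is bounded below on [sqrt (2 * k) - 1, sqrt (2 * k)].\<close>
      assume "\<not> (V k)\<^sup>2 < 2 * k"
      then have "sqrt (2 * k) \<le> sqrt ((V k)\<^sup>2)" by (intro real_sqrt_le_mono) simp
      then have "sqrt (2 * k) \<le> V k" using elim by simp
      define t where "t = sqrt (2 * k)"
      have t: "t \<ge> 2" unfolding t_def using elim by (intro real_le_rsqrt) simp
      have tk: "k = t\<^sup>2 / 2" using elim by (simp add: t_def)
      have "0 \<le> k / (t - 1) - (t - 1) / 2" "k / (t - 1) - (t - 1) / 2 \<le> 3 / 2"
        using t by (auto simp: tk field_simps power2_eq_square)
      then have "(k / (t - 1) - (t - 1) / 2)\<^sup>2 \<le> (3 / 2)\<^sup>2" by (rule power_mono[rotated])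
      then have "std_normal_density (3 / 2) \<le> (t - (t - 1)) * std_normal_density (k / (t - 1) - (t - 1) / 2)"
        by (simp add: std_normal_density_def divide_right_mono)
      also have "\<dots> \<le> cBS k t"
        using t elim by (intro cBS_lower) (auto simp: tk)
      also have "\<dots> \<le> cBS k (V k)"
        using \<open>sqrt (2 * k) \<le> V k\<close> t cBS_strict_mono[of t "V k" k] by (cases "t = V k") (auto simp flip: t_def)
      finally show False using elim by auto
    qed
  qed
  have lower: "\<forall>\<^sub>F k in at_top. psi (L k / k) \<le> (V k)\<^sup>2 / k"
    using V c_pos V_less eventually_gt_at_top[of 0]
  proof eventually_elim
    case (elim k)
    have "ln (c k) \<le> ln (exp (- (k / V k - V k / 2)\<^sup>2 / 2))"
      using elim cBS_upper[of k "V k"] by (subst ln_le_cancel_iff) auto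
    then have "(k / V k - V k / 2)\<^sup>2 / (2 * k) \<le> L k / k"
      using elim by (simp add: L_def field_simps)
    moreover have "0 \<le> (k / V k - V k / 2)\<^sup>2 / (2 * k)" using elim by simp
    ultimately show ?case
      using elim by (subst variance_eq_psi) (auto intro: psi_antimono)
  qed
  \<comment> \<open>Of the three factors \<open>1 - n\<close>, two come from
    \<open>s\<^sup>2\<close> with \<open>s = (1 - n) * V k\<close>, and one from
    \<open>psi_scale\<close>.\<close>
  have upper: "\<forall>\<^sub>F k in at_top. (V k)\<^sup>2 / k \<le> psi (L k / k) / (1 - n) ^ 3" if n: "0 < n" "n < 1" for n
  proof -
    \<comment> \<open>The right side will be a lower bound for the vega prefactor
      \<open>n * V k / sqrt (2 * pi)\<close>. The factor \<open>1 + 1 / e\<close> arises from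
      \<open>k \<le> L k / e\<close>, which bounds \<open>L k + k\<close>.\<close>
    have "\<forall>\<^sub>F l in at_top. exp (- (n * l)) \<le> n / sqrt (2 * pi) * sqrt (1 / (2 * l * (1 + 1 / e)))"
    proof -
      define p q where "p = n / sqrt (2 * pi)" and "q = 1 + 1 / e"
      have "p > 0" "q > 0" using n e by (auto simp: p_def q_def add_pos_pos)
      then have "\<forall>\<^sub>F l in at_top. exp (- (n * l)) \<le> p * sqrt (1 / (2 * l * q))"
        using n by real_asymp
      then show ?thesis by (simp add: p_def q_def)
    qed
    from eventually_compose_filterlim[OF this L_top]
    have "\<forall>\<^sub>F k in at_top. exp (- (n * L k)) \<le> n / sqrt (2 * pi) * sqrt (1 / (2 * L k * (1 + 1 / e)))" .
    with V c_pos V_less lower L_ge show ?thesis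
      using eventually_ge_at_top[of 1]
    proof eventually_elim
      case (elim k)
      have L: "L k > 0" using e elim(5,7) by (smt (verit) mult_pos_pos)
      define s where "s = (1 - n) * V k"
      have s: "0 < s" "s < V k" using n elim by (auto simp: s_def)
      define D where "D = k / s - s / 2"
      have s2: "s\<^sup>2 \<le> 2 * k"
      proof -
        have "s\<^sup>2 \<le> (V k)\<^sup>2" using s by (intro power_mono) auto
        then show ?thesis using elim by linarith
      qed
      \<comment> \<open>The bound \<open>lower\<close> feeds back here: combined with
        \<open>psi_ge\<close> it gives
        \<open>(V k)\<^sup>2 \<ge> k\<^sup>2 / (2 * (L k + k))\<close>, and \<open>k \<ge> 1\<close>
        removes the numerator.\<close>
      have "1 / (2 * L k * (1 + 1 / e)) \<le> k\<^sup>2 / (2 * (L k + k))"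
      proof -
        have "L k + k \<le> L k * (1 + 1 / e)" using elim e by (simp add: field_simps)
        then have "1 / (2 * L k * (1 + 1 / e)) \<le> 1 / (2 * (L k + k))"
          using L elim e by (intro divide_left_mono) (auto intro!: mult_pos_pos add_pos_pos)
        also have "\<dots> \<le> k\<^sup>2 / (2 * (L k + k))"
          using L elim by (intro divide_right_mono) auto
        finally show ?thesis .
      qed
      also have "\<dots> = k * (1 / (2 * (L k / k + 1)))" using elim L by (simp add: field_simps power2_eq_square)
      also have "\<dots> \<le> k * psi (L k / k)" using elim L by (intro mult_left_mono psi_ge) auto
      also have "\<dots> \<le> (V k)\<^sup>2" using elim by (simp add: field_simps)
      finally have "sqrt (1 / (2 * L k * (1 + 1 / e))) \<le> V k"
        using elim by (intro real_le_lsqrt) auto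
      then have "n / sqrt (2 * pi) * sqrt (1 / (2 * L k * (1 + 1 / e))) \<le> n / sqrt (2 * pi) * V k"
        using n by (intro mult_left_mono) auto
      with elim have "exp (- (n * L k)) * exp (- D\<^sup>2 / 2) \<le> (n / sqrt (2 * pi) * V k) * exp (- D\<^sup>2 / 2)"
        by (intro mult_right_mono) auto
      also have "\<dots> = (V k - s) * std_normal_density D"
        by (simp add: s_def std_normal_density_def algebra_simps)
      also have "\<dots> \<le> c k"
        using cBS_lower[of k s "V k"] elim s by (simp add: D_def)
      finally have "exp (- (n * L k) + - D\<^sup>2 / 2) \<le> c k" by (simp only: exp_add)
      then have "ln (exp (- (n * L k) + - D\<^sup>2 / 2)) \<le> ln (c k)"
        using elim by (subst ln_le_cancel_iff) auto
      then have "(1 - n) * L k \<le> D\<^sup>2 / 2" by (simp add: L_def algebra_simps)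
      then have "(1 - n) * L k / k \<le> D\<^sup>2 / 2 / k" using elim by (intro divide_right_mono) auto
      then have "(1 - n) * (L k / k) \<le> D\<^sup>2 / (2 * k)" by simp
      moreover have "0 \<le> (1 - n) * (L k / k)" using n L elim by simp
      ultimately have "psi (D\<^sup>2 / (2 * k)) \<le> psi ((1 - n) * (L k / k))" by (rule psi_antimono[rotated])
      also have "\<dots> \<le> psi (L k / k) / (1 - n)" using n L elim by (intro psi_scale) auto
      also have "psi (D\<^sup>2 / (2 * k)) = s\<^sup>2 / k"
        unfolding D_def using s s2 elim by (intro variance_eq_psi[symmetric]) auto
      also have "s\<^sup>2 / k = (1 - n)\<^sup>2 * ((V k)\<^sup>2 / k)" by (simp add: s_def power_mult_distrib)
      finally show ?case using n by (simp add: pos_le_divide_eq power2_eq_square power3_eq_cube mult_ac)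
    qed
  qed
  have psi_L: "\<forall>\<^sub>F k in at_top. psi (L k / k) > 0"
    using L_ge eventually_gt_at_top[of 0]
    by eventually_elim (use e in \<open>auto intro!: psi_pos divide_nonneg_pos elim: order_trans[rotated]\<close>)
  show "((\<lambda>k. (V k)\<^sup>2 / k / psi (- ln (c k) / k)) \<longlongrightarrow> 1) at_top"
    unfolding L_def[symmetric]
  proof (rule order_tendstoI)
    fix b :: real assume b: "b < 1"
    show "\<forall>\<^sub>F k in at_top. b < (V k)\<^sup>2 / k / psi (L k / k)"
      using lower psi_L
    proof eventually_elim
      case (elim k)
      then have "1 \<le> (V k)\<^sup>2 / k / psi (L k / k)" by (subst le_divide_eq_1_pos)
      then show ?case using b by linarith
    qed
  next
    fix b :: real assume b: "b > 1"
    have "((\<lambda>n::real. 1 / (1 - n) ^ 3) \<longlongrightarrow> 1) (at_right 0)" by real_asymp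
    then have "\<forall>\<^sub>F n::real in at_right 0. 1 / (1 - n) ^ 3 < b" using b by (rule order_tendstoD)
    moreover have "\<forall>\<^sub>F n::real in at_right 0. n \<in> {0<..<1}" by (rule eventually_at_right_real) simp
    ultimately have "\<forall>\<^sub>F n::real in at_right 0. 1 / (1 - n) ^ 3 < b \<and> 0 < n \<and> n < 1" by eventually_elim auto
    then obtain n :: real where n: "0 < n" "n < 1" "1 / (1 - n) ^ 3 < b"
      using eventually_happens'[of "at_right (0::real)"] by force
    show "\<forall>\<^sub>F k in at_top. (V k)\<^sup>2 / k / psi (L k / k) < b"
      using upper[OF n(1,2)] psi_L
    proof eventually_elim
      case (elim k)
      then have "(V k)\<^sup>2 / k / psi (L k / k) \<le> psi (L k / k) / (1 - n) ^ 3 / psi (L k / k)"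
        by (intro divide_right_mono) auto
      also have "\<dots> = 1 / (1 - n) ^ 3" using elim by simp
      finally show ?case using n by simp
    qed
  qed
qed

section \<open>Laws with an exponential moment\<close>

lemma antimono_borel_measurable:
  fixes h :: "real \<Rightarrow> real"
  assumes "\<And>x y. x \<le> y \<Longrightarrow> h y \<le> h x"
  shows "h \<in> borel_measurable borel"
proof -
  have "(\<lambda>x. - h x) \<in> borel_measurable borel"
    using assms by (intro borel_measurable_mono) (auto simp: mono_def)
  then show ?thesis by (simp add: borel_measurable_uminus_eq)
qed

locale light_tailed_law = prob_space M for M :: "real measure" +
  fixes e :: real
  assumes sets_M [measurable_cong]: "sets M = sets borel"
    and e_pos: "e > 0"
    and moment_finite: "(\<integral>\<^sup>+ x. ennreal (exp ((1 + e) * x)) \<partial>M) < \<infinity>"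
begin

definition moment :: real where
  "moment = (LINT x|M. exp ((1 + e) * x))"

text \<open>The payoff without the strike. Unlike the call payoff it splits additively at
  intermediate points, which is what the grid argument needs.\<close>

definition tail :: "real \<Rightarrow> real" where
  "tail y = (LINT x|M. indicator {y<..} x * exp x)"

lemma space_M: "space M = UNIV"
  using sets_eq_imp_space_eq[OF sets_M] by simp

lemma integrable_moment: "integrable M (\<lambda>x. exp ((1 + e) * x))"
  using moment_finite by (intro integrableI_nonneg) auto

lemma moment_nonneg: "moment \<ge> 0"
  by (simp add: moment_def)

text \<open>Below \<open>z\<close> the first term suffices, above it the second. With
  \<open>z = 0\<close> this yields integrability; with \<open>z = k\<close> the first term is
  absorbed by the strike.\<close>

lemma exp_le_split: "exp x \<le> exp z + exp (- e * z) * exp ((1 + e) * x)" for x z :: real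
proof (cases "x \<le> z")
  case True
  then show ?thesis by (simp add: add_increasing2)
next
  case False
  then have "x \<le> - e * z + (1 + e) * x"
    using mult_left_mono[of z x e] e_pos by (simp add: algebra_simps)
  then have "exp x \<le> exp (- e * z) * exp ((1 + e) * x)"
    by (simp flip: exp_add)
  then show ?thesis by (simp add: add_increasing)
qed

lemma integrable_exp: "integrable M exp"
proof (rule Bochner_Integration.integrable_bound)
  show "integrable M (\<lambda>x. exp 0 + exp (- e * 0) * exp ((1 + e) * x))"
    using integrable_moment by auto
  show "AE x in M. norm (exp x) \<le> norm (exp 0 + exp (- e * 0) * exp ((1 + e) * x))"
    using exp_le_split[of _ 0] by (auto intro!: AE_I2 order_trans[OF _ abs_ge_self])
qed simp

lemma integrable_indicator_exp: "A \<in> sets borel \<Longrightarrow> integrable M (\<lambda>x. indicator A x * exp x)"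
  using integrable_mult_indicator[of A M exp] integrable_exp by (simp add: sets_M)

lemma Fbar_eq: "Fbar M y = (LINT x|M. indicator {y<..} x)"
  by (simp add: Fbar_def sets_M space_M)

lemma integrable_indicator: "A \<in> sets borel \<Longrightarrow> integrable M (indicator A :: real \<Rightarrow> real)"
  by (simp add: sets_M emeasure_eq_measure)

lemma callp_eq: "callp M k = (LINT x|M. max 0 (exp x - exp k))"
  unfolding callp_def set_lebesgue_integral_def
  by (intro Bochner_Integration.integral_cong) (auto simp: indicator_def)

lemma integrable_payoff: "integrable M (\<lambda>x. max 0 (exp x - exp k))"
  using integrable_exp by (intro integrable_max) auto

lemma Fbar_nonneg: "Fbar M k \<ge> 0"
  by (simp add: Fbar_def)

lemma callp_nonneg: "callp M k \<ge> 0"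
  unfolding callp_eq by (intro Bochner_Integration.integral_nonneg) auto

lemma Fbar_antimono: "x \<le> y \<Longrightarrow> Fbar M y \<le> Fbar M x"
  unfolding Fbar_def by (intro finite_measure_mono) (auto simp: sets_M)

lemma callp_antimono: "x \<le> y \<Longrightarrow> callp M y \<le> callp M x"
  unfolding callp_eq by (intro integral_mono integrable_payoff max.mono) auto

lemma Fbar_measurable [measurable]: "Fbar M \<in> borel_measurable borel"
  by (rule antimono_borel_measurable) (rule Fbar_antimono)

lemma callp_measurable [measurable]: "callp M \<in> borel_measurable borel"
  by (rule antimono_borel_measurable) (rule callp_antimono)

section \<open>Bounds from the exponential moment\<close>

lemma Fbar_le: "Fbar M k \<le> exp (- (1 + e) * k) * moment"
proof -
  have "Fbar M k \<le> (LINT x|M. exp (- (1 + e) * k) * exp ((1 + e) * x))"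
    unfolding Fbar_eq
  proof (rule integral_mono)
    fix x
    have "(1 + e) * k \<le> (1 + e) * x" if "k < x" using that e_pos by (intro mult_left_mono) auto
    then show "indicator {k<..} x \<le> exp (- (1 + e) * k) * exp ((1 + e) * x)"
      by (auto simp: indicator_def simp flip: exp_add) (simp add: algebra_simps)
  qed (use integrable_moment in \<open>auto intro!: integrable_indicator\<close>)
  then show ?thesis by (simp add: moment_def)
qed

lemma callp_le: "callp M k \<le> exp (- e * k) * moment"
proof -
  have "callp M k \<le> (LINT x|M. exp (- e * k) * exp ((1 + e) * x))"
    unfolding callp_eq
  proof (rule integral_mono)
    fix x
    have "exp x - exp k \<le> exp (- e * k) * exp ((1 + e) * x)" using exp_le_split[of x k] by simp
    then show "max 0 (exp x - exp k) \<le> exp (- e * k) * exp ((1 + e) * x)" by simp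
  qed (use integrable_moment integrable_payoff in auto)
  then show ?thesis by (simp add: moment_def)
qed

lemma callp_ge:
  assumes "k \<le> y"
  shows "(exp y - exp k) * Fbar M y \<le> callp M k"
proof -
  have "(LINT x|M. (exp y - exp k) * indicator {y<..} x) \<le> callp M k"
    unfolding callp_eq
    by (intro integral_mono integrable_payoff integrable_mult_right integrable_indicator)
      (auto simp: indicator_def le_max_iff_disj)
  then show ?thesis by (simp add: Fbar_eq)
qed

lemma callp_le_tail: "callp M k \<le> tail k"
  unfolding callp_eq tail_def
  by (intro integral_mono integrable_payoff integrable_indicator_exp) (auto simp: indicator_def)

text \<open>Up to \<open>z\<close> the weight is at most \<open>exp z\<close> and the mass at most
  \<open>Fbar M y\<close>; beyond \<open>z\<close> the second term takes over.\<close>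

lemma tail_split: "tail y \<le> exp z * Fbar M y + tail z"
proof -
  have "tail y \<le> (LINT x|M. exp z * indicator {y<..} x + indicator {z<..} x * exp x)"
    unfolding tail_def
    by (intro integral_mono Bochner_Integration.integrable_add integrable_mult_right integrable_indicator
        integrable_indicator_exp) (auto simp: indicator_def)
  also have "\<dots> = exp z * Fbar M y + tail z"
    by (subst Bochner_Integration.integral_add)
      (auto simp: tail_def Fbar_eq intro!: integrable_indicator_exp integrable_indicator)
  finally show ?thesis .
qed

lemma tail_le_moment: "tail z \<le> exp (- e * z) * moment"
proof -
  have "tail z \<le> (LINT x|M. exp (- e * z) * exp ((1 + e) * x))"
    unfolding tail_def
  proof (rule integral_mono)
    fix x
    have "x \<le> - e * z + (1 + e) * x" if "z < x"
      using that mult_left_mono[of z x e] e_pos by (simp add: algebra_simps)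
    then show "indicator {z<..} x * exp x \<le> exp (- e * z) * exp ((1 + e) * x)"
      by (auto simp: indicator_def simp flip: exp_add)
  qed (use integrable_moment in \<open>auto intro!: integrable_indicator_exp\<close>)
  then show ?thesis by (simp add: moment_def)
qed

text \<open>The power \<open>e / (1 + e)\<close> of the tail probability is the one that Hoelder's
  inequality gives with exponent \<open>1 + e\<close> on the exponential.\<close>

lemma tail_le_Fbar_powr:
  assumes "Fbar M y > 0"
  shows "tail y \<le> (1 + moment) * exp (ln (Fbar M y) * (e / (1 + e)))"
proof -
  \<comment> \<open>This threshold balances the two terms of tail_split.\<close>
  define z where "z = - ln (Fbar M y) / (1 + e)"
  have "exp z * Fbar M y = exp (z + ln (Fbar M y))" using assms by (simp add: exp_add)
  also have "z + ln (Fbar M y) = ln (Fbar M y) * (e / (1 + e))"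
    using e_pos by (simp add: z_def field_simps)
  finally have "exp z * Fbar M y = exp (ln (Fbar M y) * (e / (1 + e)))" .
  moreover have "- e * z = ln (Fbar M y) * (e / (1 + e))" by (simp add: z_def)
  ultimately show ?thesis
    using tail_split[of y z] tail_le_moment[of z] by (simp add: algebra_simps)
qed

text \<open>Each cell pairs the exponential at its right end with the tail probability at its left
  end. The mismatch is a factor \<open>r\<close> in the exponent, which forces \<open>r\<close> to
  be close to 1.\<close>

lemma tail_partition: "tail k \<le> (\<Sum>n<N. exp (k * r ^ Suc n) * Fbar M (k * r ^ n)) + tail (k * r ^ N)"
proof (induction N)
  case (Suc N)
  then show ?case using tail_split[of "k * r ^ N" "k * r ^ Suc N"] by simp
qed simp

text \<open>Since \<open>ln 0 = 0\<close>, strict positivity of \<open>- ln\<close> excludes a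
  vanishing tail.\<close>

lemma Fbar_pos_of_regvar:
  assumes "regvar a (\<lambda>k. - ln (Fbar M k))"
  shows "\<forall>\<^sub>F k in at_top. Fbar M k > 0"
proof -
  have "\<forall>\<^sub>F k in at_top. - ln (Fbar M k) > 0" using assms by (simp add: regvar_def)
  then show ?thesis by eventually_elim (use Fbar_nonneg in \<open>force simp: less_le\<close>)
qed

lemma callp_pos_of_regvar:
  assumes "regvar a (\<lambda>k. - ln (callp M k))"
  shows "\<forall>\<^sub>F k in at_top. callp M k > 0"
proof -
  have "\<forall>\<^sub>F k in at_top. - ln (callp M k) > 0" using assms by (simp add: regvar_def)
  then show ?thesis by eventually_elim (use callp_nonneg in \<open>force simp: less_le\<close>)
qed

text \<open>Half of the excess rate \<open>e\<close> is spent on absorbing the constant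
  \<open>moment\<close>.\<close>

lemma log_Fbar_ge:
  assumes "\<forall>\<^sub>F k in at_top. Fbar M k > 0"
  shows "\<forall>\<^sub>F k in at_top. (1 + e / 2) * k \<le> - ln (Fbar M k)"
proof -
  have "\<forall>\<^sub>F k in at_top. C \<le> exp (e / 2 * k)" for C
    using e_pos by real_asymp
  from this[of moment] assms show ?thesis
  proof eventually_elim
    case (elim k)
    have "Fbar M k \<le> exp (- (1 + e) * k) * moment" by (rule Fbar_le)
    also have "\<dots> \<le> exp (- (1 + e) * k) * exp (e / 2 * k)" using elim by (intro mult_left_mono) auto
    also have "\<dots> = exp (- ((1 + e / 2) * k))" by (simp add: algebra_simps flip: exp_add)
    finally have "Fbar M k \<le> exp (- ((1 + e / 2) * k))" .
    then have "ln (Fbar M k) \<le> ln (exp (- ((1 + e / 2) * k)))" using elim by (subst ln_le_cancel_iff) auto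
    then show ?case by simp
  qed
qed

lemma callp_exp_bound: "\<forall>\<^sub>F k in at_top. callp M k \<le> exp (- (e / 2) * k)"
proof -
  have "\<forall>\<^sub>F k in at_top. C \<le> exp (e / 2 * k)" for C
    using e_pos by real_asymp
  from this[of moment] show ?thesis
  proof eventually_elim
    case (elim k)
    have "callp M k \<le> exp (- e * k) * moment" by (rule callp_le)
    also have "\<dots> \<le> exp (- e * k) * exp (e / 2 * k)" using elim by (intro mult_left_mono) auto
    also have "\<dots> = exp (- (e / 2) * k)" by (simp add: algebra_simps flip: exp_add)
    finally show ?case .
  qed
qed

section \<open>From the tail to the call price\<close>

lemma log_callp_asymp:
  assumes rv: "regvar a (\<lambda>k. - ln (Fbar M k))"
  shows "\<forall>\<^sub>F k in at_top. callp M k > 0"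
    and "(\<lambda>k. - ln (callp M k)) \<sim>[at_top] (\<lambda>k. - k - ln (Fbar M k))"
proof -
  define G where "G k = - ln (Fbar M k)" for k
  note F_pos = Fbar_pos_of_regvar[OF rv]
  from log_Fbar_ge[OF F_pos] have G_ge: "\<forall>\<^sub>F k in at_top. (1 + e / 2) * k \<le> G k"
    by (simp add: G_def)
  have a: "a \<ge> 1"
    using regvar_index_ge[OF rv, of "1 + e / 2"] e_pos G_ge by (simp add: G_def)
  have lim: "((\<lambda>k. G (l * k) / G k) \<longlongrightarrow> l powr a) at_top" if "l > 0" for l
    using rv that by (simp add: regvar_def G_def)
  \<comment> \<open>This is \<open>1 - 1 / (1 + e / 2)\<close>, the fraction of \<open>G k\<close>
    that surely survives subtracting \<open>k\<close>.\<close>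
  define \<eta> where "\<eta> = e / (2 + e)"
  have \<eta>: "\<eta> > 0" using e_pos by (simp add: \<eta>_def)
  have gap: "\<forall>\<^sub>F k in at_top. 0 < k \<and> 0 < G k \<and> 0 < G k - k \<and> \<eta> * G k \<le> G k - k"
    using G_ge eventually_gt_at_top[of 0]
  proof eventually_elim
    case (elim k)
    have "0 < e / 2 * k" using elim e_pos by simp
    with elim have "0 < G k" "k < G k" by (auto simp: algebra_simps)
    moreover have "(2 + e) * k \<le> 2 * G k" using elim by (simp add: algebra_simps)
    ultimately show ?case using elim e_pos by (simp add: \<eta>_def field_simps)
  qed
  have gap_top: "filterlim (\<lambda>k. G k - k) at_top at_top"
  proof (rule filterlim_at_top_mono)
    show "filterlim (\<lambda>k. e / 2 * k) at_top at_top" using e_pos by real_asymp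
    show "\<forall>\<^sub>F k in at_top. e / 2 * k \<le> G k - k" using G_ge by eventually_elim (simp add: algebra_simps)
  qed
  have F_pos_scaled: "\<forall>\<^sub>F k in at_top. Fbar M (r * k) > 0" if "r > 0" for r
    by (rule eventually_compose_filterlim[OF F_pos]) (use that in real_asymp)
  show c_pos: "\<forall>\<^sub>F k in at_top. callp M k > 0"
    using F_pos_scaled[of 2, simplified] eventually_gt_at_top[of 0]
  proof eventually_elim
    case (elim k)
    then have "0 < (exp (2 * k) - exp k) * Fbar M (2 * k)" by simp
    also have "\<dots> \<le> callp M k" using elim by (intro callp_ge) simp
    finally show ?case .
  qed

  have upper: "\<forall>\<^sub>F k in at_top. - ln (callp M k) \<le> (1 + \<epsilon>) * (G k - k)" if \<epsilon>: "\<epsilon> > 0" for \<epsilon>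
  proof -
    \<comment> \<open>A single strike \<open>r * k\<close> bounds the price from below. Here
      \<open>r powr a\<close> is \<open>1 + \<epsilon> * \<eta> / 2\<close>, so \<open>G\<close>
      grows by less than \<open>\<epsilon> * \<eta> * G k\<close>, hence by less than
      \<open>\<epsilon> * (G k - k)\<close>.\<close>
    define r where "r = (1 + \<epsilon> * \<eta> / 2) powr (1 / a)"
    have p: "1 + \<epsilon> * \<eta> / 2 > 1" using \<epsilon> \<eta> by simp
    have r: "r > 1" using p a unfolding r_def by simp
    have ra: "r powr a < 1 + \<epsilon> * \<eta>"
      using p \<epsilon> \<eta> a by (simp add: r_def powr_powr)
    have "\<forall>\<^sub>F k in at_top. G (r * k) / G k < 1 + \<epsilon> * \<eta>"
      using lim[of r] r ra by (intro order_tendstoD) auto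
    moreover have "\<forall>\<^sub>F k in at_top. exp k \<le> exp (r * k) - exp k" using r by real_asymp
    moreover have "\<forall>\<^sub>F k in at_top. Fbar M (r * k) > 0" using r by (intro F_pos_scaled) simp
    ultimately show ?thesis
      using gap c_pos
    proof eventually_elim
      case (elim k)
      have "exp (k - G (r * k)) = exp k * Fbar M (r * k)" using elim by (simp add: G_def exp_add)
      also have "\<dots> \<le> (exp (r * k) - exp k) * Fbar M (r * k)"
        using elim by (intro mult_right_mono Fbar_nonneg) auto
      also have "\<dots> \<le> callp M k" using elim r by (intro callp_ge) auto
      finally have "ln (exp (k - G (r * k))) \<le> ln (callp M k)"
        using elim by (subst ln_le_cancel_iff) auto
      then have "- ln (callp M k) \<le> G (r * k) - k" by simp
      also have "G (r * k) \<le> (1 + \<epsilon> * \<eta>) * G k" using elim by (simp add: field_simps)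
      also have "(1 + \<epsilon> * \<eta>) * G k - k \<le> (1 + \<epsilon>) * (G k - k)"
        using mult_left_mono[of "\<eta> * G k" "G k - k" \<epsilon>] elim \<epsilon> by (simp add: algebra_simps)
      finally show ?case by simp
    qed
  qed

  \<comment> \<open>Scaling G by \<lambda> \<ge> 1 multiplies it by about \<lambda>^a \<ge> \<lambda>, so each cell of the geometric grid contributes at most about exp (k - G k).\<close>
  have lower: "\<forall>\<^sub>F k in at_top. (1 - 2 * \<epsilon>) * (G k - k) \<le> - ln (callp M k)" if \<epsilon>: "0 < \<epsilon>" "\<epsilon> < 1 / 2" for \<epsilon>
  proof -
    \<comment> \<open>Two losses share \<open>\<delta>\<close>: the factor
      \<open>1 - \<delta>\<close> on \<open>G\<close> and the grid ratio
      \<open>1 + \<delta>\<close>. Together they cost \<open>\<delta> * (G k + k)\<close>, at most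
      \<open>\<epsilon> * (G k - k)\<close>. The cap 1/2 keeps
      \<open>1 - \<delta> \<ge> 1 / 2\<close> for the remaining tail.\<close>
    define \<delta> where "\<delta> = min (1 / 2) (\<epsilon> * \<eta> / 2)"
    define r where "r = 1 + \<delta>"
    have \<delta>: "0 < \<delta>" "\<delta> \<le> 1 / 2" "2 * \<delta> \<le> \<epsilon> * \<eta>" using \<epsilon> \<eta> by (auto simp: \<delta>_def)
    have r: "r > 1" using \<delta> by (simp add: r_def)
    \<comment> \<open>The grid k * r ^ n, n \<le> N, reaches so far that the crude moment bound on the remaining tail suffices.\<close>
    obtain N where N: "2 * (1 + e) / e < r ^ N" using real_arch_pow[OF r] by blast
    have powers: "\<forall>\<^sub>F k in at_top. \<forall>n\<in>{..N}. (1 - \<delta>) * r ^ n * G k \<le> G (k * r ^ n)"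
    proof (rule eventually_ball_finite[rule_format])
      fix n
      have rn: "r ^ n \<ge> 1" using r by simp
      then have "r ^ n \<le> (r ^ n) powr a" using powr_mono[of 1 a "r ^ n"] a by simp
      moreover have "(1 - \<delta>) * r ^ n < 1 * r ^ n" using \<delta> rn by (intro mult_strict_right_mono) auto
      ultimately have "(1 - \<delta>) * r ^ n < (r ^ n) powr a" by linarith
      then have "\<forall>\<^sub>F k in at_top. (1 - \<delta>) * r ^ n < G (r ^ n * k) / G k"
        using lim[of "r ^ n"] rn by (intro order_tendstoD) auto
      with gap show "\<forall>\<^sub>F k in at_top. (1 - \<delta>) * r ^ n * G k \<le> G (k * r ^ n)"
        by eventually_elim (auto simp: field_simps)
    qed simp
    have pos: "\<forall>\<^sub>F k in at_top. \<forall>n\<in>{..N}. Fbar M (k * r ^ n) > 0"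
      using F_pos_scaled[of "r ^ n" for n] r by (intro eventually_ball_finite) (auto simp: mult.commute)
    \<comment> \<open>The second \<open>\<epsilon>\<close> in \<open>1 - 2 * \<epsilon>\<close> pays
      for the constant: \<open>N\<close> cells plus \<open>1 + moment\<close> from the remaining
      tail.\<close>
    have "\<forall>\<^sub>F x in at_top. ln (real N + 1 + moment) \<le> \<epsilon> * x" using \<epsilon> by real_asymp
    from eventually_compose_filterlim[OF this gap_top]
    have "\<forall>\<^sub>F k in at_top. ln (real N + 1 + moment) \<le> \<epsilon> * (G k - k)" .
    with powers pos gap c_pos show ?thesis
    proof eventually_elim
      case (elim k)
      define E where "E = exp (- ((1 - \<epsilon>) * (G k - k)))"
      have main: "(1 - \<epsilon>) * (G k - k) \<le> (1 - \<delta>) * G k - r * k"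
      proof -
        have "\<delta> * G k + \<delta> * k \<le> 2 * \<delta> * G k" using elim \<delta> by simp
        also have "\<dots> \<le> \<epsilon> * \<eta> * G k" using \<delta> elim by (intro mult_right_mono) auto
        also have "\<dots> \<le> \<epsilon> * (G k - k)" using elim \<epsilon> by simp
        finally show ?thesis by (simp add: r_def algebra_simps)
      qed
      have gap_nonneg: "0 \<le> (1 - \<epsilon>) * (G k - k)" using elim \<epsilon> by simp
      have term_le: "exp (k * r ^ Suc n) * Fbar M (k * r ^ n) \<le> E" if "n < N" for n
      proof -
        have "(1 - \<epsilon>) * (G k - k) \<le> r ^ n * ((1 - \<epsilon>) * (G k - k))"
          using gap_nonneg r by (simp add: mult_le_cancel_right1)
        also have "\<dots> \<le> r ^ n * ((1 - \<delta>) * G k - r * k)"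
          using main r by (intro mult_left_mono) auto
        also have "\<dots> \<le> G (k * r ^ n) - k * r ^ Suc n"
          using elim(1) that by (force simp: algebra_simps)
        finally have "k * r ^ Suc n - G (k * r ^ n) \<le> - ((1 - \<epsilon>) * (G k - k))" by simp
        moreover have "exp (k * r ^ Suc n) * Fbar M (k * r ^ n) = exp (k * r ^ Suc n - G (k * r ^ n))"
          using elim(2) that by (simp add: G_def exp_add)
        ultimately show ?thesis by (simp add: E_def)
      qed
      have tail_le: "tail (k * r ^ N) \<le> (1 + moment) * E"
      proof -
        have "tail (k * r ^ N) \<le> (1 + moment) * exp (ln (Fbar M (k * r ^ N)) * (e / (1 + e)))"
          using elim(2) by (intro tail_le_Fbar_powr) auto
        also have "\<dots> \<le> (1 + moment) * E"
        proof -
          have "(1 - \<epsilon>) * (G k - k) \<le> 1 * (G k - k)" using elim \<epsilon> by (intro mult_right_mono) auto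
          also have "\<dots> \<le> G k" using elim by simp
          \<comment> \<open>The three factors multiply to 1: 1/2 stands for
            \<open>1 - \<delta>\<close>, the middle one for \<open>r ^ N\<close>, and the last is
            the exponent of \<open>tail_le_Fbar_powr\<close>.\<close>
          also have "\<dots> = (1 / 2) * (2 * (1 + e) / e) * (e / (1 + e)) * G k"
          proof -
            have "1 + e \<noteq> 0" using e_pos by simp
            then show ?thesis using e_pos by simp
          qed
          also have "\<dots> \<le> (1 - \<delta>) * r ^ N * (e / (1 + e)) * G k"
            using \<delta> N e_pos elim by (intro mult_right_mono mult_mono) auto
          also have "\<dots> = ((1 - \<delta>) * r ^ N * G k) * (e / (1 + e))" by simp
          also have "\<dots> \<le> G (k * r ^ N) * (e / (1 + e))"
            using elim(1) e_pos by (intro mult_right_mono) auto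
          finally show ?thesis using moment_nonneg by (auto intro!: mult_left_mono simp: E_def G_def)
        qed
        finally show ?thesis .
      qed
      have "callp M k \<le> (\<Sum>n<N. exp (k * r ^ Suc n) * Fbar M (k * r ^ n)) + tail (k * r ^ N)"
        using callp_le_tail tail_partition order_trans by blast
      also have "\<dots> \<le> (\<Sum>n<N. E) + (1 + moment) * E"
        using term_le tail_le by (intro add_mono sum_mono) auto
      also have "\<dots> = (real N + 1 + moment) * E" by (simp add: algebra_simps)
      finally have "ln (callp M k) \<le> ln ((real N + 1 + moment) * E)"
        using elim moment_nonneg by (subst ln_le_cancel_iff) (auto simp: E_def)
      also have "\<dots> = ln (real N + 1 + moment) - (1 - \<epsilon>) * (G k - k)"
        using moment_nonneg by (subst ln_mult_pos) (auto simp: E_def)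
      finally show ?case using elim by (simp add: algebra_simps)
    qed
  qed

  have "((\<lambda>k. - ln (callp M k) / (G k - k)) \<longlongrightarrow> 1) at_top"
  proof (rule order_tendstoI)
    fix b :: real assume b: "b < 1"
    define \<epsilon> where "\<epsilon> = min (1 / 4) ((1 - b) / 4)"
    have \<epsilon>: "0 < \<epsilon>" "\<epsilon> < 1 / 2" "b < 1 - 2 * \<epsilon>" using b by (auto simp: \<epsilon>_def min_def field_simps)
    show "\<forall>\<^sub>F k in at_top. b < - ln (callp M k) / (G k - k)"
      using lower[OF \<epsilon>(1,2)] gap
    proof eventually_elim
      case (elim k)
      then have "1 - 2 * \<epsilon> \<le> - ln (callp M k) / (G k - k)" by (subst pos_le_divide_eq) auto
      then show ?case using \<epsilon> by simp
    qed
  next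
    fix b :: real assume b: "b > 1"
    show "\<forall>\<^sub>F k in at_top. - ln (callp M k) / (G k - k) < b"
      using upper[of "(b - 1) / 2", simplified, OF b] gap
    proof eventually_elim
      case (elim k)
      then have "- ln (callp M k) / (G k - k) \<le> 1 + (b - 1) / 2" by (subst pos_divide_le_eq) auto
      then show ?case using b by (simp add: field_simps)
    qed
  qed
  then show "(\<lambda>k. - ln (callp M k)) \<sim>[at_top] (\<lambda>k. - k - ln (Fbar M k))"
    by (intro asymp_equivI') (simp only: G_def minus_diff_commute)
qed

lemma impvol_asymp:
  assumes c_pos: "\<forall>\<^sub>F k in at_top. callp M k > 0"
  shows "(\<lambda>k. (impvol M k)\<^sup>2 / k) \<sim>[at_top] (\<lambda>k. psi (- ln (callp M k) / k))"
proof (rule implied_variance_asymp[of "e / 2"])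
  show "\<forall>\<^sub>F k in at_top. impvol M k > 0 \<and> cBS k (impvol M k) = callp M k"
    using c_pos callp_exp_bound eventually_gt_at_top[of 0]
  proof eventually_elim
    case (elim k)
    then have "exp (- (e / 2) * k) < 1" using e_pos by simp
    then have "callp M k < 1" using elim by linarith
    then show ?case using elim impvol_unique_solution[of k M] by auto
  qed
qed (use e_pos c_pos callp_exp_bound in auto)

lemma log_callp_ge:
  assumes "\<forall>\<^sub>F k in at_top. callp M k > 0"
  shows "\<forall>\<^sub>F k in at_top. e / 2 * k \<le> - ln (callp M k)"
  using assms callp_exp_bound
proof eventually_elim
  case (elim k)
  then have "ln (callp M k) \<le> ln (exp (- (e / 2) * k))" by (subst ln_le_cancel_iff) auto
  then show ?case by simp
qed

section \<open>From the density to the tail\<close>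

text \<open>From below, the tail contains the interval from \<open>k\<close> to
  \<open>r * k\<close>, on which Potter's bound keeps \<open>f\<close> large. From above,
  \<open>f\<close> is split into its powers \<open>1 - \<delta>\<close> and \<open>\<delta>\<close>:
  the first is uniformly small beyond \<open>k\<close>, the second has an integrable
  majorant.\<close>

lemma log_density_asymp:
  assumes dens: "is_density M f" and rv: "regvar a (\<lambda>k. - ln (f k))" and a: "a > 0"
  shows "(\<lambda>k. - ln (f k)) \<sim>[at_top] (\<lambda>k. - ln (Fbar M k))"
proof -
  define g where "g k = - ln (f k)" for k
  have f [measurable]: "f \<in> borel_measurable borel" and f_nonneg: "\<And>x. f x \<ge> 0"
    and M_eq: "M = density lborel (\<lambda>x. ennreal (f x))"
    using dens by (auto simp: is_density_def)
  have int_f: "integrable lborel f"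
    using integrable_indicator[OF sets.top[of borel]] f_nonneg unfolding M_eq
    by (subst (asm) integrable_density) auto
  have int_fexp: "integrable lborel (\<lambda>x. f x * exp ((1 + e) * x))"
    using integrable_moment f_nonneg unfolding M_eq
    by (subst (asm) integrable_density) auto
  have moment_f: "moment = (LINT x|lborel. f x * exp ((1 + e) * x))"
    unfolding moment_def using f_nonneg by (subst M_eq, subst integral_density) auto
  have Fbar_f: "Fbar M k = (LINT x|lborel. f x * indicator {k<..} x)" for k
    unfolding Fbar_eq using f_nonneg by (subst M_eq, subst integral_density) auto
  have rv_g: "regvar a g" using rv by (simp add: g_def[abs_def])
  have g_top: "filterlim g at_top at_top" by (rule regvar_at_top[OF rv_g a])
  have f_exp: "f x = exp (- g x)" if "g x > 0" for x
  proof -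
    have "f x \<noteq> 0" using that by (auto simp: g_def)
    then show ?thesis using f_nonneg[of x] by (simp add: g_def)
  qed

  have upper: "\<forall>\<^sub>F k in at_top. Fbar M k > 0 \<and> - ln (Fbar M k) \<le> b * g k" if b: "b > 1" for b
  proof -
    \<comment> \<open>Potter's total loss across the interval: its constant
      \<open>exp \<epsilon>\<close> times the power \<open>a + \<epsilon>\<close> of the ratio
      \<open>r = exp \<epsilon>\<close>. It tends to 1, so it drops below \<open>b\<close>.\<close>
    define p where "p \<epsilon> = exp \<epsilon> * exp \<epsilon> powr (a + \<epsilon>)" for \<epsilon> :: real
    have "(p \<longlongrightarrow> 1) (at_right 0)" unfolding p_def by real_asymp
    then have "\<forall>\<^sub>F \<epsilon> in at_right 0. p \<epsilon> < b" using b by (rule order_tendstoD)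
    moreover have "\<forall>\<^sub>F \<epsilon>::real in at_right 0. 0 < \<epsilon>" by real_asymp
    ultimately have "\<forall>\<^sub>F \<epsilon> in at_right 0. p \<epsilon> < b \<and> 0 < \<epsilon>" by eventually_elim auto
    then obtain \<epsilon> where \<epsilon>: "0 < \<epsilon>" "p \<epsilon> < b"
      using eventually_happens'[of "at_right (0::real)"] by force
    define r where "r = exp \<epsilon>"
    have r: "r > 1" using \<epsilon> by (simp add: r_def)
    obtain K where K: "K > 0" "\<And>x. x \<ge> K \<Longrightarrow> g x > 0"
      "\<And>x y. K \<le> x \<Longrightarrow> x \<le> y \<Longrightarrow> g y \<le> exp \<epsilon> * (y / x) powr (a + \<epsilon>) * g x"
      using regvar_Potter[OF rv_g \<epsilon>(1)] by blast
    have "\<forall>\<^sub>F k in at_top. 1 \<le> r * k - k" using r by real_asymp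
    then show ?thesis using eventually_ge_at_top[of K]
    proof eventually_elim
      case (elim k)
      have k: "k > 0" using elim K by simp
      have "exp (- (b * g k)) = 1 * exp (- (b * g k))" by simp
      also have "\<dots> \<le> (r * k - k) * exp (- (b * g k))" using elim by (intro mult_right_mono) auto
      also have "\<dots> = (LINT x|lborel. exp (- (b * g k)) * indicator {k<..r * k} x)"
        using r k by simp
      also have "\<dots> \<le> (LINT x|lborel. f x * indicator {k<..} x)"
      proof (rule integral_mono)
        show "integrable lborel (\<lambda>x. f x * indicator {k<..} x)"
          using integrable_mult_indicator[OF _ int_f, of "{k<..}"] by (simp add: mult.commute)
        show "integrable lborel (\<lambda>x. exp (- (b * g k)) * indicator {k<..r * k} x)"
          by (intro integrable_mult_right integrable_real_indicator) (use r k in auto)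
        fix x
        have "exp (- (b * g k)) \<le> f x" if x: "k < x" "x \<le> r * k"
        proof -
          have "g x \<le> exp \<epsilon> * (x / k) powr (a + \<epsilon>) * g k" using x elim by (intro K(3)) auto
          also have "\<dots> \<le> exp \<epsilon> * r powr (a + \<epsilon>) * g k"
            using x k a \<epsilon> K(2)[of k] elim by (intro mult_right_mono mult_left_mono powr_mono2) (auto simp: field_simps)
          also have "\<dots> \<le> b * g k"
            using \<epsilon> K(2)[of k] elim by (intro mult_right_mono) (auto simp: p_def r_def)
          finally show ?thesis using K(2)[of x] x elim by (simp add: f_exp)
        qed
        then show "exp (- (b * g k)) * indicator {k<..r * k} x \<le> f x * indicator {k<..} x"
          using f_nonneg by (auto simp: indicator_def)
      qed
      also have "\<dots> = Fbar M k" by (simp add: Fbar_f)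
      finally have le: "exp (- (b * g k)) \<le> Fbar M k" .
      then have pos: "Fbar M k > 0" using exp_gt_zero less_le_trans by blast
      from le pos have "ln (exp (- (b * g k))) \<le> ln (Fbar M k)" by (subst ln_le_cancel_iff) auto
      then show ?case using pos by simp
    qed
  qed

  have lower: "\<forall>\<^sub>F k in at_top. b * g k \<le> - ln (Fbar M k)" if b: "b < 1" for b
  proof -
    \<comment> \<open>Losses of \<open>\<delta>\<close> occur in Potter's constant, in the splitting
      of \<open>f\<close> and in absorbing \<open>C\<close>, so
      \<open>1 - 4 * \<delta> \<ge> b\<close> is ample. The cap \<open>a / 2\<close> keeps the
      exponent \<open>a - \<delta>\<close> positive, so that the power of \<open>x / k\<close> is at
      least 1.\<close>
    define \<delta> where "\<delta> = min (a / 2) (min (1 / 2) ((1 - b) / 4))"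
    have \<delta>: "0 < \<delta>" "\<delta> < 1" "\<delta> < a" "b \<le> 1 - 4 * \<delta>" using b a by (auto simp: \<delta>_def min_def field_simps)
    obtain K where K: "K > 0" "\<And>x. x \<ge> K \<Longrightarrow> g x > 0"
      "\<And>x y. K \<le> x \<Longrightarrow> x \<le> y \<Longrightarrow> exp (- \<delta>) * (y / x) powr (a - \<delta>) * g x \<le> g y"
      using regvar_Potter[OF rv_g \<delta>(1)] by blast
    \<comment> \<open>The integral of the majorant: \<open>1 / \<delta>\<close> from
      \<open>exp (- \<delta> * x)\<close> on the positive half-line, written below as a rescaled
      exponential density, plus the moment.\<close>
    define C where "C = 1 / \<delta> + moment"
    have C: "C > 0" using \<delta> moment_nonneg by (simp add: C_def add_pos_nonneg)
    have prob_exp: "prob_space (density lborel (exponential_density \<delta>))"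
      by (rule prob_space_exponential_density[OF \<delta>(1)])
    have int_exp: "integrable lborel (exponential_density \<delta>)"
      and total_exp: "(LINT x|lborel. exponential_density \<delta> x) = 1"
    proof -
      have nn: "(\<integral>\<^sup>+ x. ennreal (exponential_density \<delta> x) \<partial>lborel) = 1"
        using prob_space.emeasure_space_1[OF prob_exp] by (simp add: emeasure_density)
      show "integrable lborel (exponential_density \<delta>)"
        using nn \<delta> by (intro integrableI_nonneg) (auto intro: exponential_density_nonneg)
      show "(LINT x|lborel. exponential_density \<delta> x) = 1"
        using nn \<delta> by (subst integral_eq_nn_integral) (auto intro: exponential_density_nonneg)
    qed
    have "\<forall>\<^sub>F x in at_top. ln C \<le> \<delta> * x" using \<delta> by real_asymp
    from eventually_compose_filterlim[OF this g_top]
    have "\<forall>\<^sub>F k in at_top. ln C \<le> \<delta> * g k" .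
    \<comment> \<open>The instance \<open>b = 2\<close> supplies the positivity of the tail needed
      for taking logarithms.\<close>
    with upper[of 2, simplified] show ?thesis
      using eventually_ge_at_top[of K]
    proof eventually_elim
      case (elim k)
      have k: "k > 0" and gk: "g k > 0" using elim K by auto
      define A where "A = exp (- ((1 - 2 * \<delta>) * g k))"
      have "Fbar M k = (LINT x|lborel. f x * indicator {k<..} x)" by (simp add: Fbar_f)
      also have "\<dots> \<le> (LINT x|lborel. A * (exponential_density \<delta> x / \<delta> + f x * exp ((1 + e) * x)))"
      proof (rule integral_mono)
        show "integrable lborel (\<lambda>x. f x * indicator {k<..} x)"
          using integrable_mult_indicator[OF _ int_f, of "{k<..}"] by (simp add: mult.commute)
        show "integrable lborel (\<lambda>x. A * (exponential_density \<delta> x / \<delta> + f x * exp ((1 + e) * x)))"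
          by (intro integrable_mult_right Bochner_Integration.integrable_add integrable_divide int_exp int_fexp)
        fix x
        have "f x \<le> A * (exp (- \<delta> * x) + f x * exp ((1 + e) * x))" if x: "k < x"
        proof -
          have gx: "g x > 0" using x elim K by simp
          have "(1 - \<delta>) * g k \<le> exp (- \<delta>) * 1 * g k"
            using gk exp_ge_add_one_self[of "- \<delta>"] by (intro mult_right_mono) auto
          also have "\<dots> \<le> exp (- \<delta>) * (x / k) powr (a - \<delta>) * g k"
            using x k gk \<delta> by (intro mult_right_mono mult_left_mono ge_one_powr_ge_zero) auto
          also have "\<dots> \<le> g x" using x elim by (intro K(3)) auto
          finally have "(1 - \<delta>) * ((1 - \<delta>) * g k) \<le> (1 - \<delta>) * g x" using \<delta> by (intro mult_left_mono) auto
          moreover have "(1 - 2 * \<delta>) * g k \<le> (1 - \<delta>) * ((1 - \<delta>) * g k)"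
            using gk \<delta> by (simp add: algebra_simps)
          ultimately have "exp (- ((1 - \<delta>) * g x)) \<le> A" by (simp add: A_def)
          \<comment> \<open>The power f^\<delta> is integrable on (0, \<infinity>): it is dominated by an exponential where f is small, by the moment where it is not.\<close>
          moreover have "exp (- (\<delta> * g x)) \<le> exp (- \<delta> * x) + f x * exp ((1 + e) * x)"
          proof (cases "x \<le> g x")
            case True
            then have "exp (- (\<delta> * g x)) \<le> exp (- \<delta> * x)" using \<delta> by simp
            then show ?thesis using f_nonneg[of x] by (simp add: add_increasing2)
          next
            case False
            have "(1 - \<delta>) * g x \<le> 1 * g x" using gx \<delta> by (intro mult_right_mono) auto
            also have "\<dots> \<le> x + e * x" using False e_pos k x by (simp add: add_increasing2)
            finally have "exp (- (\<delta> * g x)) \<le> exp (- g x + (1 + e) * x)" by (simp add: algebra_simps)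
            also have "\<dots> = f x * exp ((1 + e) * x)" by (simp only: f_exp[OF gx] exp_add)
            finally show ?thesis by (simp add: add_increasing)
          qed
          ultimately have "exp (- ((1 - \<delta>) * g x)) * exp (- (\<delta> * g x)) \<le> A * (exp (- \<delta> * x) + f x * exp ((1 + e) * x))"
            by (intro mult_mono) (auto simp: A_def)
          moreover have "exp (- ((1 - \<delta>) * g x)) * exp (- (\<delta> * g x)) = f x"
            using gx by (simp add: f_exp algebra_simps flip: exp_add)
          ultimately show ?thesis by simp
        qed
        then show "f x * indicator {k<..} x \<le> A * (exponential_density \<delta> x / \<delta> + f x * exp ((1 + e) * x))"
          using f_nonneg[of x] \<delta> k
          by (auto simp: indicator_def exponential_density_def mult.commute A_def intro!: mult_nonneg_nonneg add_nonneg_nonneg)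
      qed
      also have "\<dots> = A * C"
        using int_exp int_fexp total_exp by (simp add: moment_f C_def)
      finally have "ln (Fbar M k) \<le> ln (A * C)" using elim C by (subst ln_le_cancel_iff) (auto simp: A_def)
      also have "\<dots> = ln C - (1 - 2 * \<delta>) * g k" using C by (subst ln_mult_pos) (auto simp: A_def)
      finally have "(1 - 3 * \<delta>) * g k \<le> - ln (Fbar M k)" using elim by (simp add: algebra_simps)
      moreover have "b * g k \<le> (1 - 3 * \<delta>) * g k" using gk \<delta> by (intro mult_right_mono) auto
      ultimately show ?case by simp
    qed
  qed

  have "\<forall>\<^sub>F k in at_top. g k > 0" using rv_g by (simp add: regvar_def)
  then have "((\<lambda>k. - ln (Fbar M k) / g k) \<longlongrightarrow> 1) at_top"
  proof (intro order_tendstoI)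
    fix b :: real assume b: "b < 1"
    then have "b < (1 + b) / 2" "(1 + b) / 2 < 1" by auto
    from lower[OF this(2)] \<open>\<forall>\<^sub>F k in at_top. g k > 0\<close>
    show "\<forall>\<^sub>F k in at_top. b < - ln (Fbar M k) / g k"
    proof eventually_elim
      case (elim k)
      then have "(1 + b) / 2 \<le> - ln (Fbar M k) / g k" by (subst pos_le_divide_eq) auto
      then show ?case using \<open>b < (1 + b) / 2\<close> by linarith
    qed
  next
    fix b :: real assume b: "b > 1"
    then have "(1 + b) / 2 < b" "(1 + b) / 2 > 1" by auto
    from upper[OF this(2)] \<open>\<forall>\<^sub>F k in at_top. g k > 0\<close>
    show "\<forall>\<^sub>F k in at_top. - ln (Fbar M k) / g k < b"
    proof eventually_elim
      case (elim k)
      then have "- ln (Fbar M k) / g k \<le> (1 + b) / 2" by (subst pos_divide_le_eq) auto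
      then show ?case using \<open>(1 + b) / 2 < b\<close> by linarith
    qed
  qed
  then show ?thesis
    by (intro asymp_equiv_symI[OF asymp_equivI']) (simp add: g_def)
qed

end

section \<open>Tail-wing formula\<close>

theorem theorem1:
  fixes M :: "real measure" and a :: real
  assumes prob: "prob_space M"
    and sets_M: "sets M = sets borel"
    and mart: "(\<integral>\<^sup>+ x. ennreal (exp x) \<partial>M) = 1"
    and IR: "\<exists>e>0. (\<integral>\<^sup>+ x. ennreal (exp ((1 + e) * x)) \<partial>M) < \<infinity>"
    and a_pos: "a > 0"
  shows
    "(\<forall>f. is_density M f \<and> regvar a (\<lambda>k. - ln (f k))
          \<longrightarrow> regvar a (\<lambda>k. - ln (Fbar M k)))
   \<and> (regvar a (\<lambda>k. - ln (Fbar M k)) \<longrightarrow> regvar a (\<lambda>k. - ln (callp M k)))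
   \<and> (regvar a (\<lambda>k. - ln (callp M k)) \<longrightarrow>
        (\<lambda>k. (impvol M k)\<^sup>2 / k) \<sim>[at_top] (\<lambda>k. psi (- ln (callp M k) / k)))
   \<and> (regvar a (\<lambda>k. - ln (Fbar M k)) \<longrightarrow>
        (\<lambda>k. - ln (callp M k)) \<sim>[at_top] (\<lambda>k. - k - ln (Fbar M k)) \<and>
        (\<lambda>k. (impvol M k)\<^sup>2 / k) \<sim>[at_top] (\<lambda>k. psi (- 1 - ln (Fbar M k) / k)))
   \<and> (\<forall>f. is_density M f \<and> regvar a (\<lambda>k. - ln (f k)) \<longrightarrow>
        (\<lambda>k. - ln (f k)) \<sim>[at_top] (\<lambda>k. - ln (Fbar M k)) \<and>
        (\<lambda>k. (impvol M k)\<^sup>2 / k) \<sim>[at_top] (\<lambda>k. psi (- 1 - ln (f k) / k)))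
   \<and> (\<forall>f. is_density M f \<and> regvar a (\<lambda>k. - ln (f k)) \<and>
          filterlim (\<lambda>k. - ln (f k) / k) at_top at_top \<longrightarrow>
        (\<lambda>k. (impvol M k)\<^sup>2 / k) \<sim>[at_top] (\<lambda>k. 1 / (- 2 * ln (f k) / k)))
   \<and> (regvar a (\<lambda>k. - ln (Fbar M k)) \<and>
          filterlim (\<lambda>k. - ln (Fbar M k) / k) at_top at_top \<longrightarrow>
        (\<lambda>k. (impvol M k)\<^sup>2 / k) \<sim>[at_top] (\<lambda>k. 1 / (- 2 * ln (Fbar M k) / k)))
   \<and> (regvar a (\<lambda>k. - ln (callp M k)) \<and>
          filterlim (\<lambda>k. - ln (callp M k) / k) at_top at_top \<longrightarrow>
        (\<lambda>k. (impvol M k)\<^sup>2 / k) \<sim>[at_top] (\<lambda>k. 1 / (- 2 * ln (callp M k) / k)))"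
proof -
  obtain e where "e > 0" "(\<integral>\<^sup>+ x. ennreal (exp ((1 + e) * x)) \<partial>M) < \<infinity>" using IR by blast
  then interpret light_tailed_law M e
    using prob sets_M by (simp add: light_tailed_law_def light_tailed_law_axioms_def)

  have ratio_pos: "\<forall>\<^sub>F k in at_top. 0 < (- k - ln (Fbar M k)) / k"
    if "\<forall>\<^sub>F k in at_top. Fbar M k > 0"
    using log_Fbar_ge[OF that] eventually_gt_at_top[of 0]
  proof eventually_elim
    case (elim k)
    have "0 < e / 2 * k" using elim e_pos by simp
    with elim show ?case by (intro divide_pos_pos) (auto simp: algebra_simps)
  qed

  have psi_args: "(\<lambda>k. psi (- 1 - ln (h k) / k)) \<sim>[at_top] (\<lambda>k. psi ((- k - ln (h k)) / k))" for h
    by (intro asymp_equiv_refl_ev eventually_mono[OF eventually_gt_at_top[of 0]]) (simp add: diff_divide_distrib)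

  have psi_small: "(\<lambda>k. (impvol M k)\<^sup>2 / k) \<sim>[at_top] (\<lambda>k. 1 / (2 * h k))"
    if "(\<lambda>k. (impvol M k)\<^sup>2 / k) \<sim>[at_top] (\<lambda>k. psi (x k))" "x \<sim>[at_top] h"
      "filterlim h at_top at_top" for x h :: "real \<Rightarrow> real"
  proof -
    have "filterlim x at_top at_top"
      using asymp_equiv_at_top_transfer[OF asymp_equiv_symI[OF that(2)] that(3)] .
    from asymp_equiv_compose'[OF psi_at_top this]
    have "(\<lambda>k. psi (x k)) \<sim>[at_top] (\<lambda>k. 1 / (2 * x k))" .
    also have "\<dots> \<sim>[at_top] (\<lambda>k. 1 / (2 * h k))"
      by (intro asymp_equiv_intros that(2))
    finally show ?thesis using that(1) asymp_equiv_trans by blast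
  qed
  \<comment> \<open>In the versions for the tail and the density the argument of \<open>psi\<close>
    carries a shift by -1, negligible against a quantity tending to infinity.\<close>
  have shift_equiv: "(\<lambda>k. - 1 + h k) \<sim>[at_top] h" if "filterlim h at_top at_top" for h :: "real \<Rightarrow> real"
  proof -
    have "(\<lambda>x::real. - 1 + x) \<sim>[at_top] (\<lambda>x. x)" by real_asymp
    from asymp_equiv_compose'[OF this that] show ?thesis .
  qed

  have callp_case: "(\<lambda>k. (impvol M k)\<^sup>2 / k) \<sim>[at_top] (\<lambda>k. psi (- ln (callp M k) / k))"
    if "regvar a (\<lambda>k. - ln (callp M k))"
    by (rule impvol_asymp[OF callp_pos_of_regvar[OF that]])

  have Fbar_case: "regvar a (\<lambda>k. - ln (callp M k))"
      "(\<lambda>k. - ln (callp M k)) \<sim>[at_top] (\<lambda>k. - k - ln (Fbar M k))"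
      "(\<lambda>k. (impvol M k)\<^sup>2 / k) \<sim>[at_top] (\<lambda>k. psi (- 1 - ln (Fbar M k) / k))"
    if rv: "regvar a (\<lambda>k. - ln (Fbar M k))"
  proof -
    note F_pos = Fbar_pos_of_regvar[OF rv]
    note c = log_callp_asymp[OF rv]
    show eq: "(\<lambda>k. - ln (callp M k)) \<sim>[at_top] (\<lambda>k. - k - ln (Fbar M k))" by (rule c)
    have "regvar a (\<lambda>k. - ln (Fbar M k) - k)"
      using rv e_pos log_Fbar_ge[OF F_pos] by (intro regvar_minus_id[of _ _ "e / 2"]) auto
    then have "regvar a (\<lambda>k. - k - ln (Fbar M k))" by (simp only: minus_diff_commute)
    from regvar_asymp_equiv[OF this asymp_equiv_symI[OF eq]]
    show "regvar a (\<lambda>k. - ln (callp M k))" by simp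
    have "(\<lambda>k. psi (- ln (callp M k) / k)) \<sim>[at_top] (\<lambda>k. psi ((- k - ln (Fbar M k)) / k))"
    proof (rule psi_asymp_equiv)
      show "(\<lambda>k. - ln (callp M k) / k) \<sim>[at_top] (\<lambda>k. (- k - ln (Fbar M k)) / k)"
        by (intro asymp_equiv_divide eq asymp_equiv_refl)
      show "\<forall>\<^sub>F k in at_top. 0 < - ln (callp M k) / k"
        using log_callp_ge[OF c(1)] eventually_gt_at_top[of 0]
      proof eventually_elim
        case (elim k)
        have "0 < e / 2 * k" using elim e_pos by simp
        with elim show ?case by (intro divide_pos_pos) auto
      qed
    qed (rule ratio_pos[OF F_pos])
    also note asymp_equiv_symI[OF psi_args[of "Fbar M"]]
    finally show "(\<lambda>k. (impvol M k)\<^sup>2 / k) \<sim>[at_top] (\<lambda>k. psi (- 1 - ln (Fbar M k) / k))"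
      using impvol_asymp[OF c(1)] asymp_equiv_trans by blast
  qed

  have density_case: "regvar a (\<lambda>k. - ln (Fbar M k))"
      "(\<lambda>k. - ln (f k)) \<sim>[at_top] (\<lambda>k. - ln (Fbar M k))"
      "(\<lambda>k. (impvol M k)\<^sup>2 / k) \<sim>[at_top] (\<lambda>k. psi (- 1 - ln (f k) / k))"
    if dens: "is_density M f" and rv: "regvar a (\<lambda>k. - ln (f k))" for f
  proof -
    show eq: "(\<lambda>k. - ln (f k)) \<sim>[at_top] (\<lambda>k. - ln (Fbar M k))"
      by (rule log_density_asymp[OF dens rv a_pos])
    show rv_F: "regvar a (\<lambda>k. - ln (Fbar M k))"
      using regvar_asymp_equiv[OF rv eq] by simp
    note F_pos = Fbar_pos_of_regvar[OF rv_F]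
    have "(\<lambda>k. - ln (f k) - k) \<sim>[at_top] (\<lambda>k. - ln (Fbar M k) - k)"
      using eq e_pos log_Fbar_ge[OF F_pos] by (intro asymp_equiv_minus_id[of _ _ "e / 2"]) auto
    then have eq': "(\<lambda>k. - k - ln (f k)) \<sim>[at_top] (\<lambda>k. - k - ln (Fbar M k))"
      by (simp only: minus_diff_commute)
    have eq'': "(\<lambda>k. (- k - ln (f k)) / k) \<sim>[at_top] (\<lambda>k. (- k - ln (Fbar M k)) / k)"
      by (intro asymp_equiv_divide eq' asymp_equiv_refl)
    note psi_args[of "Fbar M"]
    also have "(\<lambda>k. psi ((- k - ln (Fbar M k)) / k)) \<sim>[at_top] (\<lambda>k. psi ((- k - ln (f k)) / k))"
    proof (rule psi_asymp_equiv[OF asymp_equiv_symI[OF eq''] ratio_pos[OF F_pos]])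
      \<comment> \<open>The moment bound controls the tail, not \<open>f\<close> pointwise;
        equivalent functions eventually share their sign, which carries positivity over to
        \<open>f\<close>.\<close>
      show "\<forall>\<^sub>F k in at_top. 0 < (- k - ln (f k)) / k"
        using asymp_equiv_imp_eventually_same_sign[OF eq''] ratio_pos[OF F_pos]
      proof eventually_elim
        case (elim k)
        then have "sgn ((- k - ln (f k)) / k) = 1" by (simp only: sgn_pos)
        then show ?case by (simp only: sgn_1_pos)
      qed
    qed
    also note asymp_equiv_symI[OF psi_args[of f]]
    finally show "(\<lambda>k. (impvol M k)\<^sup>2 / k) \<sim>[at_top] (\<lambda>k. psi (- 1 - ln (f k) / k))"
      using Fbar_case(3)[OF rv_F] asymp_equiv_trans by blast
  qed

  have c_lim: "(\<lambda>k. (impvol M k)\<^sup>2 / k) \<sim>[at_top] (\<lambda>k. 1 / (- 2 * ln (callp M k) / k))"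
    if "regvar a (\<lambda>k. - ln (callp M k))" "filterlim (\<lambda>k. - ln (callp M k) / k) at_top at_top"
    using psi_small[OF callp_case[OF that(1)] asymp_equiv_refl that(2)] by simp
  have F_lim: "(\<lambda>k. (impvol M k)\<^sup>2 / k) \<sim>[at_top] (\<lambda>k. 1 / (- 2 * ln (Fbar M k) / k))"
    if "regvar a (\<lambda>k. - ln (Fbar M k))" "filterlim (\<lambda>k. - ln (Fbar M k) / k) at_top at_top"
    using psi_small[OF Fbar_case(3)[OF that(1)] _ that(2)] shift_equiv[OF that(2)] by simp
  have f_lim: "(\<lambda>k. (impvol M k)\<^sup>2 / k) \<sim>[at_top] (\<lambda>k. 1 / (- 2 * ln (f k) / k))"
    if "is_density M f" "regvar a (\<lambda>k. - ln (f k))" "filterlim (\<lambda>k. - ln (f k) / k) at_top at_top" for f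
    using psi_small[OF density_case(3)[OF that(1,2)] _ that(3)] shift_equiv[OF that(3)] by simp
  show ?thesis
    by (intro conjI allI impI; (elim conjE)?)
      ((rule density_case(1); assumption),
       (rule Fbar_case(1); assumption),
       (rule callp_case; assumption),
       (rule Fbar_case(2); assumption),
       (rule Fbar_case(3); assumption),
       (rule density_case(2); assumption),
       (rule density_case(3); assumption),
       (rule f_lim; assumption),
       (rule F_lim; assumption),
       (rule c_lim; assumption))
qed

end
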